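(* Fix $\rho \in (0,\infty]$, an integer $m \geq 1$ and a point $\mathbf{y} = (y_1,\dots,y_m)^T \in \mathcal{Y}_m$. For $1 \leq l \leq m$ and $N \geq 1$, let $\mathbf{u}_{l,N} := (1,y_l,\dots,y_l^{N-1})^T$ and \[ \mathsf{H}^+_l(N) := \{ a \mathbf{1}_{N \times N} + b\, \mathbf{u}_{l,N}\mathbf{u}_{l,N}^T : a \in (0,\rho), \ b \in [0,\rho-a) \}. \] If the function $F : (0,\rho)^m \to \mathbb{R}$ is such that $F[-]$ preserves positivity on $\mathcal{P}_2((0,\rho))^m$ and on $\mathsf{H}^+_1(N) \times \dots \times \mathsf{H}^+_m(N)$ for all $N \geq 1$, then $F$ is absolutely monotonic and is the restriction of an analytic function on $D(0,\rho)^m$.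
   Context: $\mathcal{Y}_m$ is the set of all $\mathbf{y} \in (0,1)^m$ such that the scalars $\mathbf{y}^\alpha := \prod_{l=1}^m y_l^{\alpha_l}$ are distinct for all $\alpha \in \mathbb{Z}_+^m$, where $\mathbb{Z}_+ = \{0,1,2,\dots\}$. $\mathcal{P}_N(I)$ is the set of real symmetric positive semidefinite $N \times N$ matrices with entries in $I \subset \mathbb{R}$. $\mathbf{1}_{N\times N}$ is the $N \times N$ matrix with all entries $1$. $F$ acts entrywise on $m$-tuples of $N \times N$ matrices with entries in $(0,\rho)$: $F[A_1,\dots,A_m]_{ij} := F(a_{1,ij},\dots,a_{m,ij})$; "preserves positivity on" a set of $m$-tuples means $F[A_1,\dots,A_m]$ is positive semidefinite for every tuple in the set. A function $F$ on $(0,\rho)^m$ is absolutely monotonic if it is continuous and all mixed partial derivatives $D^\alpha F$, $\alpha \in \mathbb{Z}_+^m$, exist and are non-negative on $(0,\rho)^m$. $D(0,\rho)$ is the open disc of centre $0$ and radius $\rho$ in $\mathbb{C}$, with $D(0,\infty)=\mathbb{C}$. *)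

theory Defs
  imports "HOL-Analysis.Analysis" "Jordan_Normal_Form.Matrix"
begin

no_notation vec_index (infixl \<open>$\<close> 100)
no_notation Matrix.scalar_prod (infix \<open>\<bullet>\<close> 70)

(* Points of R^m and C^m are vectors indexed by a finite type 'm with m = CARD('m) elements.
   The sizes N of the test matrices vary, so those are taken from Jordan_Normal_Form.
   The radius rho is an extended real; functions on (0,rho)^m are total functions whose values
   outside (0,rho)^m play no role. *)

definition open_interval :: "ereal \<Rightarrow> real set" where
  "open_interval \<rho> = {t. 0 < t \<and> ereal t < \<rho>}"

definition open_cube :: "ereal \<Rightarrow> (real ^ 'm::finite) set" where
  "open_cube \<rho> = {x. \<forall>l. x $ l \<in> open_interval \<rho>}"

definition polydisc :: "ereal \<Rightarrow> (complex ^ 'm::finite) set" where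
  "polydisc \<rho> = {z. \<forall>l. z $ l \<in> eball 0 \<rho>}"

definition monomial :: "('a::comm_monoid_mult) ^ 'm::finite \<Rightarrow> ('m \<Rightarrow> nat) \<Rightarrow> 'a" where
  "monomial x \<alpha> = (\<Prod>l\<in>UNIV. (x $ l) ^ \<alpha> l)"

definition Y_set :: "(real ^ 'm::finite) set" where
  "Y_set = {y. (\<forall>l. 0 < y $ l \<and> y $ l < 1) \<and> inj (monomial y)}"

definition pos_semidef :: "nat \<Rightarrow> real mat \<Rightarrow> bool" where
  "pos_semidef N A \<longleftrightarrow> A \<in> carrier_mat N N \<and> transpose_mat A = A \<and>
     (\<forall>v\<in>carrier_vec N. 0 \<le> Matrix.scalar_prod v (A *\<^sub>v v))"

definition P_mats :: "nat \<Rightarrow> real set \<Rightarrow> real mat set" where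
  "P_mats N I = {A. pos_semidef N A \<and> elements_mat A \<subseteq> I}"

definition all_ones_mat :: "nat \<Rightarrow> real mat" where
  "all_ones_mat N = Matrix.mat N N (\<lambda>_. 1)"

definition geom_vec :: "nat \<Rightarrow> real \<Rightarrow> real Matrix.vec" where
  "geom_vec N t = Matrix.vec N (\<lambda>i. t ^ i)"

(* v v^T *)
definition outer_square :: "real Matrix.vec \<Rightarrow> real mat" where
  "outer_square v = Matrix.mat (dim_vec v) (dim_vec v) (\<lambda>(i, j). vec_index v i * vec_index v j)"

definition H_plus :: "ereal \<Rightarrow> real ^ 'm::finite \<Rightarrow> nat \<Rightarrow> 'm \<Rightarrow> real mat set" where
  "H_plus \<rho> y N l =
     {a \<cdot>\<^sub>m all_ones_mat N + b \<cdot>\<^sub>m outer_square (geom_vec N (y $ l)) | a b.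
        a \<in> open_interval \<rho> \<and> 0 \<le> b \<and> ereal b < \<rho> - ereal a}"

definition entrywise :: "(real ^ 'm::finite \<Rightarrow> real) \<Rightarrow> nat \<Rightarrow> ('m \<Rightarrow> real mat) \<Rightarrow> real mat" where
  "entrywise F N A = Matrix.mat N N (\<lambda>(i, j). F (\<chi> l. A l $$ (i, j)))"

definition preserves_positivity_on ::
    "(real ^ 'm::finite \<Rightarrow> real) \<Rightarrow> nat \<Rightarrow> ('m \<Rightarrow> real mat) set \<Rightarrow> bool" where
  "preserves_positivity_on F N T \<longleftrightarrow> (\<forall>A\<in>T. pos_semidef N (entrywise F N A))"

definition update_coord :: "real ^ 'm::finite \<Rightarrow> 'm \<Rightarrow> real \<Rightarrow> real ^ 'm" where
  "update_coord x l t = (\<chi> j. if j = l then t else x $ j)"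

definition partial_deriv :: "'m \<Rightarrow> (real ^ 'm::finite \<Rightarrow> real) \<Rightarrow> real ^ 'm \<Rightarrow> real" where
  "partial_deriv l F x = deriv (\<lambda>t. F (update_coord x l t)) (x $ l)"

definition iter_partial :: "'m list \<Rightarrow> (real ^ 'm::finite \<Rightarrow> real) \<Rightarrow> real ^ 'm \<Rightarrow> real" where
  "iter_partial ls F = foldr partial_deriv ls F"

(* A list ls encodes D^alpha, with alpha_l = count_list ls l, together with an order of
   differentiation; every order is required.  Since deriv is total, existence of all the
   derivatives is the separate differentiability clause.  The set S is meant to be open. *)
definition absolutely_monotonic_on :: "(real ^ 'm::finite) set \<Rightarrow> (real ^ 'm \<Rightarrow> real) \<Rightarrow> bool" where
  "absolutely_monotonic_on S F \<longleftrightarrow> continuous_on S F \<and>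
     (\<forall>ls. \<forall>x\<in>S.
        (\<forall>l. (\<lambda>t. iter_partial ls F (update_coord x l t)) differentiable at (x $ l)) \<and>
        0 \<le> iter_partial ls F x)"

(* Analyticity in several variables on an open set S: every point of S is the centre of a
   polydisc on which G is the sum of an (unconditionally convergent) power series. *)
definition multi_analytic_on :: "(complex ^ 'm::finite \<Rightarrow> complex) \<Rightarrow> (complex ^ 'm) set \<Rightarrow> bool" where
  "multi_analytic_on G S \<longleftrightarrow>
     (\<forall>c\<in>S. \<exists>r>0. \<exists>a :: ('m \<Rightarrow> nat) \<Rightarrow> complex. \<forall>z. (\<forall>l. dist (z $ l) (c $ l) < r) \<longrightarrow>
        ((\<lambda>\<alpha>. a \<alpha> * monomial (z - c) \<alpha>) has_sum G z) UNIV)"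

end

theory Submission
  imports Defs "HOL-Complex_Analysis.Great_Picard"
begin

text \<open>
  Why the theorem is true. The function \<open>F\<close> turns out to be the sum of a power series
  \<open>\<Sum>\<^sub>\<infinity>\<alpha>. c \<alpha> * monomial x \<alpha>\<close> with all \<open>c \<alpha> \<ge> 0\<close> on the whole open cube.
  From this both conclusions are read off: all partial derivatives are again such series, hence exist
  and are nonnegative, and the series with complex arguments converges absolutely on the polydisc.

  Where the series comes from. If the mixed differences of a continuous function at equally spaced
  points are all nonnegative, then its Bernstein polynomials, written in powers of the variables, have
  nonnegative coefficients, since these coefficients are multiples of mixed differences. As
  the Bernstein polynomials converge to the function and boundedness at one point bounds every
  coefficient, a diagonal subsequence makes all coefficients converge; evaluating at a slightly
  larger point controls the tails, so the limits are the coefficients of a series for \<open>F\<close>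
  (\<open>multivariate_Bernstein_eq_mixed_differences\<close>, \<open>limit_of_nonneg_polynomials\<close>).

  Where the mixed differences come from. For polynomial \<open>F\<close> the argument is one of linear algebra.
  The entries \<open>F (a + t y^(i+j))\<close> expand into sums of \<open>t^|\<beta>|\<close> times the Taylor coefficient
  of \<open>F\<close> of index \<open>\<beta>\<close> at \<open>a\<close> times \<open>(y^\<beta>)^i (y^\<beta>)^j\<close>. Since the numbers \<open>y^\<beta>\<close> are
  distinct, some vector \<open>v\<close> is orthogonal to the vectors \<open>((y^\<beta>)^i)\<close> for all relevant
  \<open>\<beta>\<close> except a chosen \<open>\<alpha>\<close>; the quadratic form at \<open>v\<close> then isolates, to leading order
  in \<open>t\<close>, the derivative of \<open>F\<close> of index \<open>\<alpha>\<close>, which must be nonnegative. In general \<open>F\<close> is only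
  known to be continuous (a consequence of the conditions on two-by-two matrices:
  \<open>continuous_on_open_cube_if_preserves_2x2\<close>), so the expansion is carried out on test
  functions instead: after integration against a product of bumps the translations by
  \<open>t y^(i+j)\<close> move to the bumps, which are expanded by Taylor's theorem
  (\<open>weak_derivative_nonneg\<close>). If each bump is an iterated moving average of a narrower one, its
  derivative is a finite difference of the narrower bump; moving this difference back to \<open>F\<close> and
  shrinking the bumps gives the sign of the mixed differences of \<open>F\<close>
  (\<open>mixed_difference_nonneg\<close>).
\<close>

section \<open>The open cube\<close>

lemma mem_open_cube_iff: "x \<in> open_cube \<rho> \<longleftrightarrow> (\<forall>l. 0 < x $ l \<and> ereal (x $ l) < \<rho>)"
  by (simp add: open_cube_def open_interval_def)

lemma ereal_less_uniform_room:
  fixes a :: "'m::finite \<Rightarrow> real"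
  assumes "\<And>l. ereal (a l) < \<rho>"
  obtains r where "0 < r" "r \<le> 1" "\<And>l. ereal (a l + r) < \<rho>"
proof -
  have "\<exists>r>0. ereal (a l + r) < \<rho>" for l
  proof -
    obtain z where "ereal (a l) < ereal z" "ereal z < \<rho>"
      using assms[of l] ereal_dense2 by blast
    then show ?thesis by (intro exI[of _ "z - a l"]) auto
  qed
  then obtain r where r: "\<And>l. 0 < r l" "\<And>l. ereal (a l + r l) < \<rho>" by metis
  define r0 where "r0 = min 1 (Min (range r))"
  have "ereal (a l + r0) < \<rho>" for l
  proof -
    have "r0 \<le> Min (range r)" by (simp add: r0_def)
    also have "\<dots> \<le> r l" by simp
    finally show ?thesis using r(2)[of l] by (meson add_left_mono ereal_less_eq(3) le_less_trans)
  qed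
  moreover have "0 < r0" "r0 \<le> 1" using r(1) by (simp_all add: r0_def)
  ultimately show ?thesis using that by blast
qed

lemma open_open_cube: "open (open_cube \<rho> :: (real ^ 'm::finite) set)"
proof -
  have "open_cube \<rho> = (\<Inter>l\<in>UNIV. {x :: real ^ 'm. 0 < x $ l} \<inter> (\<lambda>x. ereal (x $ l)) -` {..<\<rho>})"
    by (auto simp: mem_open_cube_iff)
  moreover have "open ({x :: real ^ 'm. 0 < x $ l} \<inter> (\<lambda>x. ereal (x $ l)) -` {..<\<rho>})" for l
    by (intro open_Int open_vimage open_Collect_less continuous_intros)
  ultimately show ?thesis by auto
qed

lemma open_cube_dilation:
  fixes x :: "real ^ 'm::finite"
  assumes "x \<in> open_cube \<rho>"
  obtains s where "1 < s" "s *\<^sub>R x \<in> open_cube \<rho>"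
proof -
  have "((\<lambda>s. s *\<^sub>R x) \<longlongrightarrow> 1 *\<^sub>R x) (at_right 1)" by (intro tendsto_intros)
  then have "\<forall>\<^sub>F s in at_right 1. s *\<^sub>R x \<in> open_cube \<rho>"
    using open_open_cube assms by (auto dest: topological_tendstoD)
  moreover have "\<forall>\<^sub>F s in at_right 1. (1::real) < s" by (rule eventually_at_right_less)
  ultimately have "\<forall>\<^sub>F s in at_right (1::real). 1 < s \<and> s *\<^sub>R x \<in> open_cube \<rho>"
    by eventually_elim auto
  then show ?thesis using that eventually_happens[of _ "at_right (1::real)"] by auto
qed

section \<open>Continuity from two-by-two matrices\<close>

lemma pos_semidef_mat_quadratic_form:
  assumes "pos_semidef N (Matrix.mat N N f)"
  shows "0 \<le> (\<Sum>i<N. \<Sum>j<N. v i * v j * f (i, j))"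
proof -
  have "0 \<le> Matrix.scalar_prod (Matrix.vec N v) (Matrix.mat N N f *\<^sub>v Matrix.vec N v)"
    using assms by (simp add: pos_semidef_def)
  also have "\<dots> = (\<Sum>i<N. \<Sum>j<N. v i * v j * f (i, j))"
    unfolding Matrix.scalar_prod_def
    by (auto simp: Matrix.scalar_prod_def atLeast0LessThan sum_distrib_left mult_ac
        intro!: sum.cong)
  finally show ?thesis .
qed

text \<open>
  In the tuple with parameters \<open>a l\<close> and one common \<open>b = t\<close>, the entry at \<open>(i, j)\<close> is a function of
  \<open>i + j\<close>, because \<open>u u\<^sup>T\<close> has the entry \<open>y^(i+j)\<close> there. Letting all coordinates shrink to \<open>a\<close> at
  the same speed \<open>t\<close> is what makes an expansion in the single variable \<open>t\<close> possible later.
\<close>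

lemma hankel_positivity:
  fixes y :: "real ^ 'm::finite" and F :: "real ^ 'm \<Rightarrow> real"
  assumes "preserves_positivity_on F N {A. \<forall>l. A l \<in> H_plus \<rho> y N l}"
    and a: "\<And>l. 0 < a $ l" and t: "0 \<le> t" and at: "\<And>l. ereal (a $ l + t) < \<rho>"
  shows "0 \<le> (\<Sum>i<N. \<Sum>j<N. v i * v j * F (\<chi> l. a $ l + t * (y $ l) ^ (i + j)))"
proof -
  define A where "A = (\<lambda>l. (a $ l) \<cdot>\<^sub>m all_ones_mat N + t \<cdot>\<^sub>m outer_square (geom_vec N (y $ l)))"
  have "A l \<in> H_plus \<rho> y N l" for l
  proof -
    have "ereal (a $ l) \<le> ereal (a $ l + t)" using t by simp
    then have "ereal (a $ l) < \<rho>" using at[of l] by (rule le_less_trans)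
    moreover have "ereal t < \<rho> - ereal (a $ l)"
      using at[of l] by (cases \<rho>) auto
    ultimately show ?thesis
      unfolding H_plus_def A_def open_interval_def using a[of l] t by blast
  qed
  then have "pos_semidef N (entrywise F N A)"
    using assms(1) by (simp add: preserves_positivity_on_def)
  then have "0 \<le> (\<Sum>i<N. \<Sum>j<N. v i * v j * F (\<chi> l. A l $$ (i, j)))"
    unfolding entrywise_def by (drule_tac v = v in pos_semidef_mat_quadratic_form) simp
  also have "\<dots> = (\<Sum>i<N. \<Sum>j<N. v i * v j * F (\<chi> l. a $ l + t * (y $ l) ^ (i + j)))"
    by (intro sum.cong refl)
      (simp add: A_def all_ones_mat_def outer_square_def geom_vec_def power_add)
  finally show ?thesis .
qed

text \<open>
  A symmetric matrix with diagonal \<open>p, q > 0\<close> and off-diagonal entry \<open>r\<close> is positive semidefinite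
  when \<open>r\<^sup>2 \<le> p q\<close>; completing the square shows it.
\<close>

lemma two_by_two_positivity:
  fixes F :: "real ^ 'm::finite \<Rightarrow> real"
  assumes pp: "preserves_positivity_on F 2 {A. \<forall>l. A l \<in> P_mats 2 (open_interval \<rho>)}"
    and p: "p \<in> open_cube \<rho>" and q: "q \<in> open_cube \<rho>" and r: "r \<in> open_cube \<rho>"
    and le: "\<And>l. (r $ l)\<^sup>2 \<le> p $ l * q $ l"
  shows "0 \<le> F p * c\<^sup>2 + 2 * F r * c * d + F q * d\<^sup>2"
proof -
  define A where "A = (\<lambda>l. Matrix.mat 2 2
    (\<lambda>(i::nat, j::nat). if i \<noteq> j then r $ l else if i = 0 then p $ l else q $ l))"
  have two: "{..<2} = {0, Suc 0}" "{0..<2} = {0, Suc 0}" by auto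
  have "A l \<in> P_mats 2 (open_interval \<rho>)" for l
  proof -
    have "0 \<le> Matrix.scalar_prod v (A l *\<^sub>v v)" if "v \<in> carrier_vec 2" for v
    proof -
      define s t where "s = vec_index v 0" and "t = vec_index v (Suc 0)"
      have pl: "0 < p $ l" using p by (simp add: mem_open_cube_iff)
      have "Matrix.scalar_prod v (A l *\<^sub>v v) = p $ l * s\<^sup>2 + 2 * r $ l * s * t + q $ l * t\<^sup>2"
        using that by (simp add: A_def Matrix.scalar_prod_def two s_def t_def
            power2_eq_square algebra_simps)
      moreover have "p $ l * (p $ l * s\<^sup>2 + 2 * r $ l * s * t + q $ l * t\<^sup>2)
          = (p $ l * s + r $ l * t)\<^sup>2 + (p $ l * q $ l - (r $ l)\<^sup>2) * t\<^sup>2"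
        by (simp add: power2_eq_square algebra_simps)
      moreover have "0 \<le> (p $ l * s + r $ l * t)\<^sup>2 + (p $ l * q $ l - (r $ l)\<^sup>2) * t\<^sup>2"
        using le[of l] by (intro add_nonneg_nonneg mult_nonneg_nonneg) auto
      ultimately show ?thesis using pl by (metis zero_le_mult_iff not_less)
    qed
    moreover have "A l \<in> carrier_mat 2 2" "transpose_mat (A l) = A l"
      by (auto simp: A_def)
    moreover have "elements_mat (A l) \<subseteq> open_interval \<rho>"
      using p q r by (auto simp: A_def elements_mat_def open_cube_def)
    ultimately show ?thesis by (simp add: P_mats_def pos_semidef_def)
  qed
  then have "pos_semidef 2 (entrywise F 2 A)"
    using pp by (simp add: preserves_positivity_on_def)
  then have "0 \<le> (\<Sum>i<2. \<Sum>j<2. (if i = 0 then c else d) * (if j = 0 then c else d)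
      * F (\<chi> l. A l $$ (i, j)))"
    unfolding entrywise_def
    by (drule_tac v = "\<lambda>i. if i = 0 then c else d" in pos_semidef_mat_quadratic_form) simp
  then show ?thesis
    by (simp add: two A_def power2_eq_square algebra_simps)
qed

lemma nonneg_quadratic_form_discriminant:
  fixes u v w :: real
  assumes "\<And>c d. 0 \<le> u * c\<^sup>2 + 2 * w * c * d + v * d\<^sup>2"
  shows "0 \<le> u" "w\<^sup>2 \<le> u * v"
proof -
  show u: "0 \<le> u" using assms[of 1 0] by simp
  show "w\<^sup>2 \<le> u * v"
  proof (cases "u = 0")
    case True
    have "w = 0"
    proof (rule ccontr)
      assume "w \<noteq> 0"
      then show False
        using assms[of "- (v + 1) / (2 * w)" 1] True by (simp add: field_simps)
    qed
    then show ?thesis using True by simp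
  next
    case False
    have "0 \<le> u * (u * v - w\<^sup>2)"
      using assms[of w "- u"] by (simp add: power2_eq_square algebra_simps)
    then show ?thesis using u False by (simp add: zero_le_mult_iff)
  qed
qed

text \<open>
  Along the ray \<open>s \<mapsto> exp s *\<^sub>R x\<close> the function is nondecreasing and, in logarithmic
  scale, midpoint convex. So its limits
  \<open>L\<close> and \<open>M\<close> at \<open>x\<close> from above and below satisfy \<open>L\<^sup>2 \<le> F x * L\<close> and \<open>(F x)\<^sup>2 \<le> L * M\<close>, which forces
  \<open>L = F x = M\<close>. Monotonicity in each coordinate squeezes all nearby values between values on this
  ray. No logarithm is taken, so zeros of \<open>F\<close> do no harm.
\<close>

lemma log_convex_monotone_imp_continuous:
  fixes F :: "real ^ 'm::finite \<Rightarrow> real"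
  assumes nonneg: "\<And>p. p \<in> open_cube \<rho> \<Longrightarrow> 0 \<le> F p"
    and mono: "\<And>p q. p \<in> open_cube \<rho> \<Longrightarrow> q \<in> open_cube \<rho> \<Longrightarrow> (\<And>l. q $ l \<le> p $ l) \<Longrightarrow> F q \<le> F p"
    and conv: "\<And>p q r. p \<in> open_cube \<rho> \<Longrightarrow> q \<in> open_cube \<rho> \<Longrightarrow> r \<in> open_cube \<rho> \<Longrightarrow>
      (\<And>l. (r $ l)\<^sup>2 = p $ l * q $ l) \<Longrightarrow> (F r)\<^sup>2 \<le> F p * F q"
  shows "continuous_on (open_cube \<rho>) F"
proof (intro continuous_at_imp_continuous_on ballI)
  fix x :: "real ^ 'm" assume x: "x \<in> open_cube \<rho>"
  have xpos: "0 < x $ l" for l using x by (simp add: mem_open_cube_iff)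
  obtain s where s: "1 < s" "s *\<^sub>R x \<in> open_cube \<rho>" by (rule open_cube_dilation[OF x])
  define s0 where "s0 = ln s"
  have s0: "0 < s0" "exp s0 = s" using s(1) by (simp_all add: s0_def)
  have scaled: "exp t *\<^sub>R x \<in> open_cube \<rho>" if "t \<le> s0" for t
    unfolding mem_open_cube_iff
  proof (intro allI conjI)
    fix l
    have "exp t \<le> s" using that s0(2) by (metis exp_le_cancel_iff)
    then have "(exp t *\<^sub>R x) $ l \<le> (s *\<^sub>R x) $ l" using xpos[of l] by simp
    then show "ereal ((exp t *\<^sub>R x) $ l) < \<rho>"
      using s(2) unfolding mem_open_cube_iff by (meson ereal_less_eq(3) le_less_trans)
    show "0 < (exp t *\<^sub>R x) $ l" using xpos by simp
  qed
  define g where "g = (\<lambda>s. F (exp s *\<^sub>R x))"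
  have g_mono: "g s \<le> g t" if "s \<le> t" "t \<le> s0" for s t
    unfolding g_def using that scaled xpos by (intro mono) (auto simp: less_imp_le)
  have g_conv: "(g ((s + t) / 2))\<^sup>2 \<le> g s * g t" if "s \<le> s0" "t \<le> s0" for s t
    unfolding g_def
  proof (rule conv)
    show "((exp ((s + t) / 2) *\<^sub>R x) $ l)\<^sup>2 = (exp s *\<^sub>R x) $ l * (exp t *\<^sub>R x) $ l" for l
      by (simp add: power_mult_distrib power2_eq_square flip: exp_add exp_double)
  qed (use that scaled in auto)
  have g_nonneg: "0 \<le> g s" if "s \<le> s0" for s unfolding g_def using that scaled nonneg by auto
  define a where "a = (\<lambda>k::nat. g (s0 / 2 ^ k))"
  define c where "c = (\<lambda>k::nat. g (- s0 / 2 ^ k))"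
  have small: "s0 / 2 ^ k \<le> s0" "0 < s0 / 2 ^ k" "s0 / 2 ^ Suc k \<le> s0 / 2 ^ k" for k
    using s0(1) by (auto simp: field_simps)
  have neg: "- s0 / 2 ^ k \<le> 0" for k using s0(1) by (simp add: field_simps)
  have "decseq a"
    unfolding decseq_Suc_iff a_def using small by (intro allI g_mono) auto
  moreover have a_ge: "g 0 \<le> a k" for k
    unfolding a_def using small[of k] by (intro g_mono) auto
  ultimately obtain L where L: "a \<longlonglongrightarrow> L" "\<And>k. L \<le> a k"
    using decseq_convergent[of a "g 0"] by blast
  have "incseq c"
    unfolding incseq_Suc_iff c_def
    using small s0(1) by (intro allI g_mono) (auto simp: field_simps intro: order_trans[of _ 0])
  moreover have c_le: "c k \<le> g 0" for k
    unfolding c_def using neg s0(1) by (intro g_mono) auto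
  ultimately obtain M where M: "c \<longlonglongrightarrow> M" "\<And>k. c k \<le> M"
    using incseq_convergent[of c "g 0"] by blast
  have g0: "0 \<le> g 0" using g_nonneg s0 by auto
  have "L \<le> g 0"
  proof -
    have "(a (Suc k))\<^sup>2 \<le> g 0 * a k" for k
      using g_conv[of 0 "s0 / 2 ^ k"] small[of k] s0(1) by (simp add: a_def mult.commute)
    moreover have "(\<lambda>k. (a (Suc k))\<^sup>2) \<longlonglongrightarrow> L\<^sup>2"
      by (intro tendsto_intros LIMSEQ_Suc L)
    moreover have "(\<lambda>k. g 0 * a k) \<longlonglongrightarrow> g 0 * L" by (intro tendsto_intros L)
    ultimately have "L\<^sup>2 \<le> g 0 * L" by (intro LIMSEQ_le) auto
    moreover have "0 \<le> L" using L(1) a_ge g0 by (intro LIMSEQ_le_const) (auto intro: order_trans)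
    ultimately show ?thesis using g0 by (cases "L = 0") (auto simp: power2_eq_square)
  qed
  moreover have "g 0 \<le> M"
  proof -
    have "(g 0)\<^sup>2 \<le> a k * c k" for k
      using g_conv[of "s0 / 2 ^ k" "- s0 / 2 ^ k"] small[of k] neg[of k] s0(1) by (simp add: a_def c_def)
    moreover have "(\<lambda>k. a k * c k) \<longlonglongrightarrow> L * M" by (intro tendsto_intros L M)
    ultimately have "(g 0)\<^sup>2 \<le> L * M" by (intro LIMSEQ_le_const) auto
    also have "\<dots> \<le> g 0 * M"
      using \<open>L \<le> g 0\<close> g_nonneg[of "- s0 / 2 ^ 0"] M(2)[of 0] s0(1)
      by (intro mult_right_mono) (auto simp: c_def)
    finally show ?thesis
      using g0 g_nonneg[of "- s0 / 2 ^ 0"] M(2)[of 0] s0(1)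
      by (cases "g 0 = 0") (auto simp: power2_eq_square c_def)
  qed
  ultimately have lim: "a \<longlonglongrightarrow> F x" "c \<longlonglongrightarrow> F x"
  proof -
    have "g 0 \<le> L" using L(1) a_ge by (intro LIMSEQ_le_const) auto
    moreover have "M \<le> g 0" using M(1) c_le by (intro LIMSEQ_le_const2) auto
    ultimately show "a \<longlonglongrightarrow> F x" "c \<longlonglongrightarrow> F x"
      using L(1) M(1) \<open>L \<le> g 0\<close> \<open>g 0 \<le> M\<close> by (auto simp: g_def)
  qed
  show "isCont F x"
    unfolding isCont_def
  proof (rule tendstoI)
    fix e :: real assume e: "0 < e"
    have "\<forall>\<^sub>F k in sequentially. dist (a k) (F x) < e \<and> dist (c k) (F x) < e"
      using lim e by (auto simp: tendsto_iff eventually_conj)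
    then obtain k where k: "dist (a k) (F x) < e" "dist (c k) (F x) < e"
      using eventually_happens by fastforce
    define s where "s = s0 / 2 ^ k"
    have s: "0 < s" "s \<le> s0" "F (exp s *\<^sub>R x) = a k" "F (exp (- s) *\<^sub>R x) = c k"
      using small[of k] by (auto simp: s_def a_def c_def g_def)
    \<comment> \<open>the order interval between two points of the ray is a neighbourhood of \<open>x\<close>\<close>
    have ev: "\<forall>\<^sub>F z in at x. \<forall>l. exp (- s) * x $ l < z $ l \<and> z $ l < exp s * x $ l"
    proof (rule eventually_all_finite)
      fix l
      have "((\<lambda>z. z $ l) \<longlongrightarrow> x $ l) (at x)" by (intro tendsto_intros)
      moreover have "exp (- s) * x $ l < x $ l" "x $ l < exp s * x $ l"
        using xpos[of l] s(1) by auto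
      ultimately show "\<forall>\<^sub>F z in at x. exp (- s) * x $ l < z $ l \<and> z $ l < exp s * x $ l"
        by (auto intro!: eventually_conj order_tendstoD)
    qed
    then show "\<forall>\<^sub>F z in at x. dist (F z) (F x) < e"
    proof eventually_elim
      case (elim z)
      have up: "exp s *\<^sub>R x \<in> open_cube \<rho>" and lo: "exp (- s) *\<^sub>R x \<in> open_cube \<rho>"
        using scaled[of s] scaled[of "- s"] s s0(1) by auto
      have z: "z \<in> open_cube \<rho>"
        unfolding mem_open_cube_iff
      proof (intro allI conjI)
        fix l
        show "0 < z $ l" using elim xpos[of l] by (meson exp_gt_zero mult_pos_pos order_less_trans)
        have "ereal (z $ l) < ereal (exp s * x $ l)" using elim by simp
        also have "\<dots> < \<rho>" using up by (simp add: mem_open_cube_iff)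
        finally show "ereal (z $ l) < \<rho>" .
      qed
      have "F z \<le> a k" "c k \<le> F z"
        unfolding s(3,4)[symmetric] using elim z up lo by (auto intro!: mono simp: less_imp_le)
      then show ?case using k by (auto simp: dist_real_def)
    qed
  qed
qed

text \<open>
  With off-diagonal entries equal to the smaller diagonal entry \<open>q \<le> p\<close>, the determinant gives
  \<open>(F q)\<^sup>2 \<le> F p * F q\<close>, which is monotonicity; with \<open>r\<^sup>2 = p q\<close> it gives convexity in logarithmic scale.
\<close>

lemma continuous_on_open_cube_if_preserves_2x2:
  fixes F :: "real ^ 'm::finite \<Rightarrow> real"
  assumes pp: "preserves_positivity_on F 2 {A. \<forall>l. A l \<in> P_mats 2 (open_interval \<rho>)}"
  shows "continuous_on (open_cube \<rho>) F"
proof -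
  have nonneg: "0 \<le> F p" if "p \<in> open_cube \<rho>" for p
    using two_by_two_positivity[OF pp that that that, of 1 0] by (simp add: power2_eq_square)
  have sq: "(F r)\<^sup>2 \<le> F p * F q"
    if "p \<in> open_cube \<rho>" "q \<in> open_cube \<rho>" "r \<in> open_cube \<rho>" "\<And>l. (r $ l)\<^sup>2 \<le> p $ l * q $ l" for p q r :: "real ^ 'm"
    using two_by_two_positivity[OF pp that] by (rule nonneg_quadratic_form_discriminant(2))
  show ?thesis
  proof (rule log_convex_monotone_imp_continuous)
    fix p q :: "real ^ 'm" assume pq: "p \<in> open_cube \<rho>" "q \<in> open_cube \<rho>" "\<And>l. q $ l \<le> p $ l"
    have "(F q)\<^sup>2 \<le> F p * F q"
      using pq by (intro sq) (auto simp: power2_eq_square mem_open_cube_iff less_imp_le)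
    then show "F q \<le> F p"
      using nonneg[OF pq(1)] nonneg[OF pq(2)] by (cases "F q = 0") (auto simp: power2_eq_square)
  qed (use nonneg sq in auto)
qed

section \<open>Smooth test functions with prescribed differences\<close>

text \<open>
  A bump on \<open>[c, d]\<close>, packaged with its derivatives up to order \<open>N\<close>: \<open>D k\<close> is the \<open>k\<close>-th derivative
  of \<open>D 0\<close>. Carrying the whole family spares iterated derivatives of concrete functions, and
  it is the form that Taylor's theorem asks for.
\<close>

definition bump_family :: "nat \<Rightarrow> real \<Rightarrow> real \<Rightarrow> (nat \<Rightarrow> real \<Rightarrow> real) \<Rightarrow> bool" where
  "bump_family N c d D \<longleftrightarrow>
     (\<forall>k<N. \<forall>x. (D k has_real_derivative D (Suc k) x) (at x)) \<and>
     (\<forall>k\<le>N. continuous_on UNIV (D k)) \<and>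
     (\<forall>k\<le>N. \<forall>x. x \<notin> {c..d} \<longrightarrow> D k x = 0) \<and>
     (\<forall>x. 0 \<le> D 0 x) \<and> (\<exists>x. 0 < D 0 x)"

text \<open>
  The moving average \<open>x \<mapsto> \<integral> of D 0 over [x - h, x]\<close> of a bump is a bump that is once more
  differentiable, and its derivative is the difference \<open>D 0 x - D 0 (x - h)\<close>. Hence averaging
  serves both to make bumps smoother and to turn derivatives into differences.
\<close>

lemma bump_family_average:
  assumes D: "bump_family N c d D" and h: "0 < h"
  obtains E where "bump_family (Suc N) c (d + h) E" "\<And>k x. E (Suc k) x = D k x - D k (x - h)"
proof -
  have cont: "\<And>k. k \<le> N \<Longrightarrow> continuous_on UNIV (D k)"
    and der: "\<And>k x. k < N \<Longrightarrow> (D k has_real_derivative D (Suc k) x) (at x)"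
    and supp: "\<And>k x. k \<le> N \<Longrightarrow> x \<notin> {c..d} \<Longrightarrow> D k x = 0"
    and nonneg: "\<And>x. 0 \<le> D 0 x" and pos: "\<exists>x. 0 < D 0 x"
    using D by (auto simp: bump_family_def)
  obtain \<Phi> where \<Phi>: "\<And>x. (\<Phi> has_real_derivative D 0 x) (at x)"
  proof -
    have "isCont (D 0) x" for x
      using cont[of 0] by (simp add: continuous_on_eq_continuous_at)
    then have "\<exists>\<Phi>. \<forall>x. - \<infinity> < ereal x \<longrightarrow> ereal x < \<infinity> \<longrightarrow> (\<Phi> has_vector_derivative D 0 x) (at x)"
      by (intro einterval_antiderivative) auto
    then show ?thesis
      using that by (auto simp: has_real_derivative_iff_has_vector_derivative)
  qed
  have mono: "\<Phi> x \<le> \<Phi> z" if "x \<le> z" for x z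
    using that \<Phi> nonneg by (metis DERIV_nonneg_imp_nondecreasing)
  have const: "\<Phi> x = \<Phi> z" if xz: "x < z" and outside: "\<And>w. x < w \<Longrightarrow> w < z \<Longrightarrow> w \<notin> {c..d}" for x z
  proof -
    obtain w where w: "x < w" "w < z" "\<Phi> z - \<Phi> x = (z - x) * D 0 w"
      using MVT2[OF xz, of \<Phi> "D 0"] \<Phi> by blast
    then have "D 0 w = 0" using outside supp by blast
    then show ?thesis using w by simp
  qed
  define E where "E = (\<lambda>k x. case k of 0 \<Rightarrow> \<Phi> x - \<Phi> (x - h) | Suc k \<Rightarrow> D k x - D k (x - h))"
  have E0: "E 0 x = \<Phi> x - \<Phi> (x - h)" and ES: "E (Suc k) x = D k x - D k (x - h)" for k x
    by (simp_all add: E_def)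
  have \<Phi>_cont: "continuous_on UNIV \<Phi>"
    using \<Phi> by (meson DERIV_continuous_on has_field_derivative_at_within)
  have "bump_family (Suc N) c (d + h) E"
    unfolding bump_family_def
  proof (intro conjI allI impI)
    fix k x assume k: "k < Suc N"
    show "(E k has_real_derivative E (Suc k) x) (at x)"
    proof (cases k)
      case 0
      have "((\<lambda>x. \<Phi> x - \<Phi> (x - h)) has_real_derivative D 0 x - D 0 (x - h)) (at x)"
        using \<Phi>[of x] \<Phi>[of "x - h"] DERIV_shift[of \<Phi> "D 0 (x - h)" x "- h"]
        by (auto intro!: derivative_intros)
      then show ?thesis using 0 by (simp add: E_def)
    next
      case (Suc j)
      have "((\<lambda>x. D j x - D j (x - h)) has_real_derivative D (Suc j) x - D (Suc j) (x - h)) (at x)"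
        using der[of j x] der[of j "x - h"] DERIV_shift[of "D j" "D (Suc j) (x - h)" x "- h"] k Suc
        by (auto intro!: derivative_intros)
      then show ?thesis using Suc by (simp add: E_def)
    qed
  next
    fix k assume k: "k \<le> Suc N"
    show "continuous_on UNIV (E k)"
      using k unfolding E_def
      by (cases k)
        (auto intro!: continuous_intros cont \<Phi>_cont continuous_on_compose2[OF \<Phi>_cont] continuous_on_compose2[OF cont])
  next
    fix k x assume k: "k \<le> Suc N" and x: "x \<notin> {c..d + h}"
    show "E k x = 0"
    proof (cases k)
      case 0
      have "\<Phi> (x - h) = \<Phi> x" using x h by (intro const) auto
      then show ?thesis using 0 by (simp add: E0)
    next
      case (Suc j)
      then show ?thesis using x h k supp[of j x] supp[of j "x - h"] by (auto simp: ES)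
    qed
  next
    show "0 \<le> E 0 x" for x using mono[of "x - h" x] h by (simp add: E0)
    \<comment> \<open>the average is positive at \<open>x0 + h\<close>, since \<open>\<Phi>\<close> increases strictly just after \<open>x0\<close>\<close>
    obtain x0 where "0 < D 0 x0" using pos by blast
    then obtain e where e: "0 < e" "\<And>s. 0 < s \<Longrightarrow> s < e \<Longrightarrow> \<Phi> x0 < \<Phi> (x0 + s)"
      using DERIV_pos_inc_right[OF \<Phi>] by blast
    define s where "s = min h (e / 2)"
    have "\<Phi> x0 < \<Phi> (x0 + s)" "x0 + s \<le> x0 + h" using e(1) h by (auto simp: s_def intro!: e(2))
    then have "\<Phi> x0 < \<Phi> (x0 + h)" using mono by (meson less_le_trans)
    then show "\<exists>x. 0 < E 0 x" unfolding E0 by (metis add_diff_cancel_right' diff_gt_0_iff_gt)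
  qed
  then show ?thesis using that ES by blast
qed

text \<open>
  Start from a parabolic arch of width \<open>\<delta>\<close> and average \<open>N\<close> times over windows of length \<open>\<delta>\<close>.
\<close>

lemma bump_family_exists:
  assumes "c < d"
  obtains D where "bump_family N c d D"
proof -
  define \<delta> where "\<delta> = (d - c) / (real N + 1)"
  have \<delta>: "0 < \<delta>" using assms by (simp add: \<delta>_def)
  have "\<exists>D. bump_family k c (c + \<delta> * (real k + 1)) D" for k
  proof (induction k)
    case 0
    have "bump_family 0 c (c + \<delta>) (\<lambda>_ x. max 0 ((x - c) * (c + \<delta> - x)))"
      unfolding bump_family_def
    proof (intro conjI allI impI)
      show "\<exists>x. 0 < max 0 ((x - c) * (c + \<delta> - x))"
        using \<delta> by (intro exI[of _ "c + \<delta> / 2"]) simp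
    next
      fix x assume "x \<notin> {c..c + \<delta>}"
      then have "(x - c) * (c + \<delta> - x) \<le> 0"
        using \<delta> by (intro mult_le_0_iff[THEN iffD2]) auto
      then show "max 0 ((x - c) * (c + \<delta> - x)) = 0" by simp
    qed (auto intro!: continuous_intros)
    then show ?case by auto
  next
    case (Suc k)
    then obtain D where "bump_family k c (c + \<delta> * (real k + 1)) D" by blast
    then obtain E where "bump_family (Suc k) c (c + \<delta> * (real k + 1) + \<delta>) E"
      using bump_family_average \<delta> by metis
    then show ?case by (intro exI[of _ E]) (simp add: algebra_simps)
  qed
  moreover have "c + \<delta> * (real N + 1) = d" by (simp add: \<delta>_def)
  ultimately show ?thesis using that by metis
qed

text \<open>
  Pascal's rule: the \<open>(n+1)\<close>-st backward difference is the backward difference of the \<open>n\<close>-th.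
\<close>

lemma backward_difference_Suc:
  fixes g :: "real \<Rightarrow> real"
  shows "(\<Sum>j\<le>n. (-1) ^ j * real (n choose j) * g (x - real j * h))
      - (\<Sum>j\<le>n. (-1) ^ j * real (n choose j) * g (x - h - real j * h))
    = (\<Sum>j\<le>Suc n. (-1) ^ j * real (Suc n choose j) * g (x - real j * h))"
proof -
  have "(\<Sum>j\<le>Suc n. (-1) ^ j * real (Suc n choose j) * g (x - real j * h))
    = g x + (\<Sum>j\<le>n. - ((-1) ^ j) * real (n choose Suc j) * g (x - h - real j * h))
      - (\<Sum>j\<le>n. (-1) ^ j * real (n choose j) * g (x - h - real j * h))"
    by (subst sum.atMost_Suc_shift)
      (simp add: algebra_simps sum.distrib sum_negf sum_subtractf)
  moreover have "(\<Sum>j\<le>n. (-1) ^ j * real (n choose j) * g (x - real j * h))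
    = (\<Sum>j\<le>Suc n. (-1) ^ j * real (n choose j) * g (x - real j * h))"
    by simp
  moreover have "\<dots> = g x + (\<Sum>j\<le>n. - ((-1) ^ j) * real (n choose Suc j) * g (x - h - real j * h))"
    by (subst sum.atMost_Suc_shift) (simp add: algebra_simps)
  ultimately show ?thesis by linarith
qed

lemma bump_family_iterated_average:
  assumes D: "bump_family N c d D" and h: "0 < h"
  obtains E where "bump_family (N + n) c (d + real n * h) E"
    "\<And>x. E n x = (\<Sum>j\<le>n. (-1) ^ j * real (n choose j) * D 0 (x - real j * h))"
proof -
  have "\<exists>E. bump_family (N + n) c (d + real n * h) E \<and>
    (\<forall>x. E n x = (\<Sum>j\<le>n. (-1) ^ j * real (n choose j) * D 0 (x - real j * h)))"
  proof (induction n)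
    case 0
    then show ?case using D by auto
  next
    case (Suc n)
    then obtain E where E: "bump_family (N + n) c (d + real n * h) E"
      "\<And>x. E n x = (\<Sum>j\<le>n. (-1) ^ j * real (n choose j) * D 0 (x - real j * h))" by blast
    obtain E' where E': "bump_family (Suc (N + n)) c (d + real n * h + h) E'"
      "\<And>k x. E' (Suc k) x = E k x - E k (x - h)"
      using bump_family_average[OF E(1) h] by metis
    have "E' (Suc n) x = (\<Sum>j\<le>Suc n. (-1) ^ j * real (Suc n choose j) * D 0 (x - real j * h))" for x
      unfolding E'(2) E(2) by (rule backward_difference_Suc)
    then show ?case using E'(1) by (intro exI[of _ E']) (simp add: algebra_simps)
  qed
  then show ?thesis using that by blast
qed

lemma bump_family_bounded:
  assumes D: "bump_family N c d D" and k: "k \<le> N"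
  obtains K where "\<And>x. \<bar>D k x\<bar> \<le> K"
proof -
  have "continuous_on {c..d} (D k)"
    using D k unfolding bump_family_def by (meson continuous_on_subset subset_UNIV)
  then have "bounded (D k ` {c..d})"
    by (intro compact_imp_bounded compact_continuous_image) auto
  then obtain K where K: "\<And>x. x \<in> {c..d} \<Longrightarrow> \<bar>D k x\<bar> \<le> K"
    unfolding bounded_real by blast
  have "\<bar>D k x\<bar> \<le> max K 0" for x
    using K[of x] D k by (cases "x \<in> {c..d}") (auto simp: bump_family_def)
  then show ?thesis using that by blast
qed

text \<open>
  The Taylor polynomial of \<open>s \<mapsto> D 0 (x - s)\<close> at \<open>s = 0\<close>; the shift is to the left, hence the signs.
\<close>

definition taylor_poly :: "nat \<Rightarrow> (nat \<Rightarrow> real \<Rightarrow> real) \<Rightarrow> real \<Rightarrow> real \<Rightarrow> real" where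
  "taylor_poly n D x s = (\<Sum>k\<le>n. (- 1) ^ k * D k x / fact k * s ^ k)"

text \<open>
  The remainder is bounded uniformly in \<open>x\<close>, because the next derivative of a bump is bounded on the line.
\<close>

lemma bump_family_taylor:
  assumes D: "bump_family N c d D" and n: "n < N"
  obtains C where "\<And>x s. 0 \<le> s \<Longrightarrow> \<bar>D 0 (x - s) - taylor_poly n D x s\<bar> \<le> C * s ^ Suc n"
proof -
  obtain K where K: "\<And>x. \<bar>D (Suc n) x\<bar> \<le> K"
    using bump_family_bounded[OF D] n by (metis Suc_leI)
  have "\<bar>D 0 (x - s) - taylor_poly n D x s\<bar> \<le> K * s ^ Suc n" if s: "0 \<le> s" for x s
  proof (cases "s = 0")
    case True
    have "(\<Sum>k\<le>n. (- 1) ^ k * D k x / fact k * 0 ^ k) = D 0 x"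
      by (subst sum.atMost_shift) simp
    then show ?thesis by (simp add: taylor_poly_def True)
  next
    case False
    have "\<exists>t. x - s < t \<and> t < x \<and> D 0 (x - s) =
        (\<Sum>m<Suc n. (D m x / fact m) * (x - s - x) ^ m) + (D (Suc n) t / fact (Suc n)) * (x - s - x) ^ Suc n"
      using D n s False by (intro Taylor_down[of _ D _ _ x]) (auto simp: bump_family_def)
    then obtain t where t: "D 0 (x - s) =
        (\<Sum>m<Suc n. (D m x / fact m) * (- s) ^ m) + (D (Suc n) t / fact (Suc n)) * (- s) ^ Suc n"
      by auto
    have "(\<Sum>m<Suc n. (D m x / fact m) * (- s) ^ m) = taylor_poly n D x s"
      unfolding taylor_poly_def lessThan_Suc_atMost
      by (intro sum.cong refl) (simp add: power_minus[of s] mult_ac)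
    then have "\<bar>D 0 (x - s) - taylor_poly n D x s\<bar> = \<bar>D (Suc n) t\<bar> / fact (Suc n) * s ^ Suc n"
      using t s by (simp add: abs_mult power_abs del: power_Suc)
    also have "\<dots> \<le> \<bar>D (Suc n) t\<bar> * s ^ Suc n"
      using s by (intro mult_right_mono) (auto simp: divide_le_eq mult_le_cancel_left1 simp del: fact_Suc)
    also have "\<dots> \<le> K * s ^ Suc n"
      using s by (intro mult_right_mono K) auto
    finally show ?thesis .
  qed
  then show ?thesis using that by blast
qed

lemma abs_prod_diff_le:
  fixes z w :: "'i \<Rightarrow> real"
  assumes K: "0 < K" and "\<And>i. i \<in> I \<Longrightarrow> \<bar>z i\<bar> \<le> K" "\<And>i. i \<in> I \<Longrightarrow> \<bar>w i\<bar> \<le> K"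
  shows "\<bar>(\<Prod>i\<in>I. z i) - (\<Prod>i\<in>I. w i)\<bar> \<le> K ^ card I * (\<Sum>i\<in>I. \<bar>z i - w i\<bar> / K)"
proof -
  have "norm ((\<Prod>i\<in>I. z i / K) - (\<Prod>i\<in>I. w i / K)) \<le> (\<Sum>i\<in>I. norm (z i / K - w i / K))"
    using assms by (intro norm_prod_diff) auto
  also have "\<dots> = (\<Sum>i\<in>I. \<bar>z i - w i\<bar> / K)"
    using K by (simp add: diff_divide_distrib[symmetric])
  also have "(\<Prod>i\<in>I. z i / K) - (\<Prod>i\<in>I. w i / K) = ((\<Prod>i\<in>I. z i) - (\<Prod>i\<in>I. w i)) / K ^ card I"
    by (simp add: prod_dividef diff_divide_distrib)
  finally show ?thesis using K by (simp add: field_simps)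
qed

text \<open>
  Products of bumps are the test functions in several variables. Only one-dimensional expansions are needed:
  a difference of products is controlled by the differences of the factors.
\<close>

lemma bump_product_taylor:
  fixes D :: "'m::finite \<Rightarrow> nat \<Rightarrow> real \<Rightarrow> real"
  assumes D: "\<And>l. bump_family (N l) (c l) (d l) (D l)" and n: "\<And>l. n < N l"
  obtains C where "\<forall>x s t. (\<forall>l. 0 \<le> s l \<and> s l \<le> t) \<longrightarrow> t \<le> 1 \<longrightarrow>
     \<bar>(\<Prod>l\<in>UNIV. D l 0 (x l - s l)) - (\<Prod>l\<in>UNIV. taylor_poly n (D l) (x l) (s l))\<bar> \<le> C * t ^ Suc n"
proof -
  have "\<exists>C. \<forall>x s. 0 \<le> s \<longrightarrow> \<bar>D l 0 (x - s) - taylor_poly n (D l) x s\<bar> \<le> C * s ^ Suc n" for l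
    using bump_family_taylor[OF D n] by metis
  then obtain C where C: "\<And>l x s. 0 \<le> s \<Longrightarrow> \<bar>D l 0 (x - s) - taylor_poly n (D l) x s\<bar> \<le> C l * s ^ Suc n"
    by metis
  have "\<exists>K. \<forall>x. \<bar>D l 0 x\<bar> \<le> K" for l
    using bump_family_bounded[OF D] by (metis zero_le)
  then obtain K0 where K0: "\<And>l x. \<bar>D l 0 x\<bar> \<le> K0 l" by metis
  have C0: "0 \<le> C l" for l using C[of 1 l 0] by simp
  \<comment> \<open>one bound for all the bumps and, since \<open>s \<le> 1\<close>, also for their Taylor polynomials\<close>
  define K where "K = 1 + (\<Sum>l\<in>UNIV. C l + K0 l)"
  have K0': "0 \<le> K0 l" for l using K0[of l 0] by linarith
  have Kl: "C l + K0 l \<le> K" for l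
  proof -
    have "C l + K0 l \<le> (\<Sum>l\<in>UNIV. C l + K0 l)"
      using C0 K0' by (intro member_le_sum) auto
    then show ?thesis by (simp add: K_def)
  qed
  have Kpos: "0 < K" unfolding K_def using C0 K0' by (simp add: add_pos_nonneg sum_nonneg)
  have "\<bar>(\<Prod>l\<in>UNIV. D l 0 (x l - s l)) - (\<Prod>l\<in>UNIV. taylor_poly n (D l) (x l) (s l))\<bar>
      \<le> (K ^ CARD('m) * (\<Sum>l\<in>UNIV. C l / K)) * t ^ Suc n"
    if s: "\<And>l. 0 \<le> s l \<and> s l \<le> t" and t: "t \<le> 1" for x s t
  proof -
    have st: "C l * s l ^ Suc n \<le> C l * t ^ Suc n" for l
      using s C0 by (intro mult_left_mono power_mono) auto
    have t0: "0 \<le> t" using s[of undefined] by linarith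
    have t1: "t ^ Suc n \<le> 1" using t t0 by (rule power_le_one[rotated])
    have bd: "\<bar>D l 0 (x l - s l)\<bar> \<le> K \<and> \<bar>taylor_poly n (D l) (x l) (s l)\<bar> \<le> K" for l
    proof -
      have "C l * t ^ Suc n \<le> C l" using t1 C0[of l] by (rule mult_left_le)
      then show ?thesis
        using C[of "s l" l "x l"] s[of l] st[of l] K0[of l "x l - s l"] Kl[of l] C0[of l] K0'[of l]
        by linarith
    qed
    have "\<bar>(\<Prod>l\<in>UNIV. D l 0 (x l - s l)) - (\<Prod>l\<in>UNIV. taylor_poly n (D l) (x l) (s l))\<bar>
       \<le> K ^ CARD('m) * (\<Sum>l\<in>UNIV. \<bar>D l 0 (x l - s l) - taylor_poly n (D l) (x l) (s l)\<bar> / K)"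
      using bd by (intro abs_prod_diff_le Kpos) auto
    also have "\<dots> \<le> K ^ CARD('m) * (\<Sum>l\<in>UNIV. (C l * t ^ Suc n) / K)"
    proof -
      have "\<bar>D l 0 (x l - s l) - taylor_poly n (D l) (x l) (s l)\<bar> \<le> C l * t ^ Suc n" for l
        using C[of "s l" l "x l"] s[of l] st[of l] by linarith
      then show ?thesis
        using Kpos by (intro mult_left_mono sum_mono divide_right_mono) auto
    qed
    also have "\<dots> = (K ^ CARD('m) * (\<Sum>l\<in>UNIV. C l / K)) * t ^ Suc n"
      by (simp add: sum_distrib_right sum_distrib_left mult_ac del: power_Suc)
    finally show ?thesis .
  qed
  then show ?thesis using that by blast
qed

section \<open>Mixed derivatives are nonnegative against test functions\<close>

text \<open>
  The vector is formed by the coefficients of the polynomial with zero set \<open>S\<close>.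
\<close>

lemma vector_annihilating_powers:
  fixes z :: real
  assumes "finite S" "z \<notin> S"
  obtains N v where "1 \<le> N" "\<forall>s\<in>S. (\<Sum>i<N. v i * s ^ i) = 0" "(\<Sum>i<N. v i * z ^ i) \<noteq> 0"
proof -
  define p where "p = (\<Prod>s\<in>S. [:- s, 1:])"
  have "(\<Sum>i<Suc (degree p). coeff p i * x ^ i) = (\<Prod>s\<in>S. x - s)" for x
    by (simp add: lessThan_Suc_atMost poly_altdef[symmetric] p_def poly_prod)
  then show ?thesis
    using assms that[of "Suc (degree p)" "coeff p"] by auto
qed

lemma Collect_le_fun_eq_PiE: "{\<beta> :: 'm \<Rightarrow> nat. \<forall>l. \<beta> l \<le> \<alpha> l} = (\<Pi>\<^sub>E l\<in>UNIV. {..\<alpha> l})"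
  by auto

lemma finite_Collect_le_fun: "finite {\<beta> :: 'm::finite \<Rightarrow> nat. \<forall>l. \<beta> l \<le> \<alpha> l}"
  unfolding Collect_le_fun_eq_PiE by (intro finite_PiE) auto

lemma prod_sum_le_fun:
  fixes f :: "'m::finite \<Rightarrow> nat \<Rightarrow> 'b::comm_semiring_1"
  shows "(\<Prod>l\<in>UNIV. \<Sum>k\<le>\<alpha> l. f l k) = (\<Sum>\<beta> | \<forall>l. \<beta> l \<le> \<alpha> l. \<Prod>l\<in>UNIV. f l (\<beta> l))"
  unfolding Collect_le_fun_eq_PiE by (rule prod_sum_PiE) auto

text \<open>
  The algebraic heart. A tensor polynomial at the point \<open>t y^(i+j)\<close> is a sum over \<open>\<beta>\<close> of rank one
  matrices \<open>((y^\<beta>)^i (y^\<beta>)^j)\<close>; a vector orthogonal to all the vectors involved but that of \<open>\<alpha>\<close>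
  singles out the coefficient of index \<open>\<alpha>\<close>.
\<close>

lemma quadratic_form_tensor_polynomial:
  fixes y :: "real ^ 'm::finite" and \<alpha> :: "'m \<Rightarrow> nat" and A :: "'m \<Rightarrow> nat \<Rightarrow> real"
  assumes zero: "\<And>\<beta>. (\<forall>l. \<beta> l \<le> n) \<Longrightarrow> \<beta> \<noteq> \<alpha> \<Longrightarrow> (\<Sum>i<N. v i * monomial y \<beta> ^ i) = 0"
    and \<alpha>: "\<And>l. \<alpha> l \<le> n"
  shows "(\<Sum>i<N. \<Sum>j<N. v i * v j * (\<Prod>l\<in>UNIV. \<Sum>k\<le>n. A l k * (t * (y $ l) ^ (i + j)) ^ k))
    = (\<Prod>l\<in>UNIV. A l (\<alpha> l)) * t ^ (\<Sum>l\<in>UNIV. \<alpha> l) * (\<Sum>i<N. v i * monomial y \<alpha> ^ i)\<^sup>2"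
proof -
  let ?B = "{\<beta> :: 'm \<Rightarrow> nat. \<forall>l. \<beta> l \<le> n}"
  let ?a = "\<lambda>\<beta>. (\<Prod>l\<in>UNIV. A l (\<beta> l)) * t ^ (\<Sum>l\<in>UNIV. \<beta> l)"
  have "(\<Prod>l\<in>UNIV. \<Sum>k\<le>n. A l k * (t * (y $ l) ^ (i + j)) ^ k)
      = (\<Sum>\<beta>\<in>?B. ?a \<beta> * monomial y \<beta> ^ i * monomial y \<beta> ^ j)" for i j
    unfolding prod_sum_le_fun
    by (intro sum.cong refl) (simp add: prod.distrib power_mult_distrib power_sum monomial_def
       power_add prod_power_distrib mult_ac flip: power_mult)
  then have "(\<Sum>i<N. \<Sum>j<N. v i * v j * (\<Prod>l\<in>UNIV. \<Sum>k\<le>n. A l k * (t * (y $ l) ^ (i + j)) ^ k))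
     = (\<Sum>i<N. \<Sum>j<N. \<Sum>\<beta>\<in>?B. ?a \<beta> * (v i * monomial y \<beta> ^ i) * (v j * monomial y \<beta> ^ j))"
    by (simp add: sum_distrib_left mult_ac)
  also have "\<dots> = (\<Sum>i<N. \<Sum>\<beta>\<in>?B. \<Sum>j<N. ?a \<beta> * (v i * monomial y \<beta> ^ i) * (v j * monomial y \<beta> ^ j))"
    by (intro sum.cong refl sum.swap)
  also have "\<dots> = (\<Sum>\<beta>\<in>?B. \<Sum>i<N. \<Sum>j<N. ?a \<beta> * (v i * monomial y \<beta> ^ i) * (v j * monomial y \<beta> ^ j))"
    by (rule sum.swap)
  also have "\<dots> = (\<Sum>\<beta>\<in>?B. ?a \<beta> * (\<Sum>i<N. v i * monomial y \<beta> ^ i)\<^sup>2)"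
    unfolding power2_eq_square sum_product by (simp add: sum_distrib_left mult.assoc)
  also have "\<dots> = (\<Sum>\<beta>\<in>?B. if \<beta> = \<alpha> then ?a \<beta> * (\<Sum>i<N. v i * monomial y \<beta> ^ i)\<^sup>2 else 0)"
    using zero by (intro sum.cong) auto
  also have "\<dots> = ?a \<alpha> * (\<Sum>i<N. v i * monomial y \<alpha> ^ i)\<^sup>2"
    using \<alpha> finite_Collect_le_fun[of "\<lambda>_. n"] by (subst sum.delta) auto
  finally show ?thesis .
qed

text \<open>
  An integral over the whole space, written with boxes: if \<open>g\<close> vanishes outside the translated box, the
  larger domain \<open>Q\<close> does not matter. In the uses of this lemma \<open>Q\<close> stays fixed while the
  translation \<open>u\<close> varies.
\<close>

lemma integral_translated_support:
  fixes c d u :: "'a::euclidean_space" and g :: "'a \<Rightarrow> real"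
  assumes sub: "cbox (c + u) (d + u) \<subseteq> Q"
    and zero: "\<And>x. x \<in> Q \<Longrightarrow> x \<notin> cbox (c + u) (d + u) \<Longrightarrow> g x = 0"
  shows "integral Q g = integral (cbox c d) (\<lambda>x. g (x + u))"
proof -
  have "integral (cbox c d) (\<lambda>x. g (x + u)) = integral (cbox (c + u) (d + u)) g"
    using integral_shift_cbox[of "c + u" u "d + u" g] by simp
  also have "\<dots> = integral Q (\<lambda>x. if x \<in> cbox (c + u) (d + u) then g x else 0)"
    using sub by (simp add: integral_restrict_Int inf.absorb1 inf.absorb2)
  also have "\<dots> = integral Q g"
    using zero by (intro integral_cong) auto
  finally show ?thesis by simp
qed

lemma linear_dominates_power_nonneg:
  fixes A C t0 :: real
  assumes t0: "0 < t0" and le: "\<And>t. 0 < t \<Longrightarrow> t \<le> t0 \<Longrightarrow> 0 \<le> A * t ^ n + C * t ^ Suc n"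
  shows "0 \<le> A"
proof (rule tendsto_lowerbound)
  show "((\<lambda>t. A + C * t) \<longlongrightarrow> A) (at_right 0)"
    by (auto intro!: tendsto_eq_intros)
  have "0 \<le> A + C * t" if "0 < t" "t \<le> t0" for t
  proof -
    have "0 \<le> t ^ n * (A + C * t)" using le[OF that] by (simp add: algebra_simps)
    then show ?thesis using that mult_left_le_imp_le[of "t ^ n" 0 "A + C * t"] by simp
  qed
  then show "\<forall>\<^sub>F t in at_right 0. 0 \<le> A + C * t"
    unfolding eventually_at_right_field using t0 by (intro exI[of _ t0]) auto
qed auto

text \<open>
  The sign of the derivative of \<open>F\<close> of index \<open>\<alpha>\<close>, tested against the product of the bumps \<open>D l 0\<close>
  and with the derivatives moved to these bumps; this accounts for the factors \<open>(-1) ^ \<alpha> l\<close>.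

  Take the quadratic form of the Hankel matrix based at \<open>x\<close>, integrate it against the product of
  the bumps, and translate: this is the integral of \<open>F * \<psi> t\<close>, where \<open>\<psi> t\<close> is a
  combination of shifted bumps. By Taylor's theorem and the choice of \<open>v\<close>, the function \<open>\<psi> t\<close> equals
  a positive multiple of \<open>t ^ n\<close> times the desired test function \<open>L\<close>, up to \<open>O(t ^ (n + 1))\<close>
  uniformly in \<open>x\<close>. Dividing by \<open>t ^ n\<close> and letting \<open>t\<close> tend to \<open>0\<close> gives the claim.
\<close>

lemma weak_derivative_nonneg:
  fixes y :: "real ^ 'm::finite" and F :: "real ^ 'm \<Rightarrow> real" and \<alpha> :: "'m \<Rightarrow> nat"
  assumes y: "y \<in> Y_set"
    and cont: "continuous_on (open_cube \<rho>) F"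
    and hankel: "\<And>N v t a. 1 \<le> N \<Longrightarrow> (\<And>l. 0 < a $ l) \<Longrightarrow> 0 \<le> t \<Longrightarrow> (\<And>l. ereal (a $ l + t) < \<rho>) \<Longrightarrow>
       0 \<le> (\<Sum>i<N. \<Sum>j<N. v i * v j * F (\<chi> l. a $ l + t * (y $ l) ^ (i + j)))"
    and D: "\<And>l. bump_family (M l) (c $ l) (d $ l) (D l)" and M: "\<And>l. (\<Sum>l\<in>UNIV. \<alpha> l) < M l"
    and c: "\<And>l. 0 < c $ l" and d: "\<And>l. ereal (d $ l) < \<rho>"
  shows "0 \<le> integral (cbox c d) (\<lambda>x. F x * (\<Prod>l\<in>UNIV. (-1) ^ \<alpha> l * D l (\<alpha> l) (x $ l)))"
proof -
  define n where "n = (\<Sum>l\<in>UNIV. \<alpha> l)"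
  have \<alpha>n: "\<alpha> l \<le> n" for l unfolding n_def by (rule member_le_sum) auto
  have ypos: "0 < y $ l" "y $ l < 1" for l using y by (auto simp: Y_set_def)
  have yinj: "inj (monomial y)" using y by (simp add: Y_set_def)
  have Dcont: "continuous_on UNIV (D l k)" if "k \<le> n" for l k
    using D[of l] M[of l] that by (auto simp: bump_family_def n_def)
  have Dsupp: "D l k x = 0" if "x \<notin> {c $ l..d $ l}" "k \<le> n" for l k x
    using D[of l] M[of l] that by (auto simp: bump_family_def n_def)
  obtain t0 where t0: "0 < t0" "t0 \<le> 1" "\<And>l. ereal (d $ l + t0) < \<rho>"
    using ereal_less_uniform_room[of "\<lambda>l. d $ l" \<rho>] d by metis
  \<comment> \<open>a box that contains the supports of all the bumps shifted by at most \<open>t0\<close>\<close>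
  define Q where "Q = cbox c (d + (\<chi> l. t0))"
  have Qcube: "Q \<subseteq> open_cube \<rho>"
  proof
    fix x assume x: "x \<in> Q"
    show "x \<in> open_cube \<rho>" unfolding mem_open_cube_iff
    proof (intro allI conjI)
      fix l
      have xl: "c $ l \<le> x $ l" "x $ l \<le> d $ l + t0" using x by (auto simp: Q_def mem_box_cart)
      then show "0 < x $ l" using c[of l] by linarith
      show "ereal (x $ l) < \<rho>" using xl t0(3)[of l] by (metis ereal_less_eq(3) le_less_trans)
    qed
  qed
  have contF: "continuous_on Q F" using cont Qcube by (rule continuous_on_subset)
  \<comment> \<open>the Taylor polynomials of order \<open>n\<close> in each variable involve the indices \<open>\<beta>\<close> with all \<open>\<beta> l \<le> n\<close>\<close>
  obtain N v where v: "1 \<le> N" "\<forall>s\<in>monomial y ` ({\<beta>. \<forall>l. \<beta> l \<le> n} - {\<alpha>}). (\<Sum>i<N. v i * s ^ i) = 0"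
      "(\<Sum>i<N. v i * monomial y \<alpha> ^ i) \<noteq> 0"
  proof -
    have fin: "finite (monomial y ` ({\<beta>. \<forall>l. \<beta> l \<le> n} - {\<alpha>}))"
      using finite_Collect_le_fun[of "\<lambda>_. n"] by auto
    have "monomial y \<alpha> \<notin> monomial y ` ({\<beta>. \<forall>l. \<beta> l \<le> n} - {\<alpha>})"
      using yinj by (auto dest: injD)
    from vector_annihilating_powers[OF fin this] show ?thesis using that .
  qed
  define P where "P = (\<Sum>i<N. v i * monomial y \<alpha> ^ i)\<^sup>2"
  have P: "0 < P" using v(3) by (simp add: P_def)
  have nM: "n < M l" for l using M by (simp add: n_def)
  obtain C where C: "\<forall>x s t. (\<forall>l. 0 \<le> s l \<and> s l \<le> t) \<longrightarrow> t \<le> 1 \<longrightarrow>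
     \<bar>(\<Prod>l\<in>UNIV. D l 0 (x l - s l)) - (\<Prod>l\<in>UNIV. taylor_poly n (D l) (x l) (s l))\<bar> \<le> C * t ^ Suc n"
    by (rule bump_product_taylor[OF D nM])
  define W where "W = (\<Sum>i<N. \<Sum>j<N. \<bar>v i * v j\<bar>)"
  define L where "L = (\<lambda>x :: real ^ 'm. (\<Prod>l\<in>UNIV. (-1) ^ \<alpha> l * D l (\<alpha> l) (x $ l)))"
  define \<kappa> where "\<kappa> = P / (\<Prod>l\<in>UNIV. fact (\<alpha> l))"
  have \<kappa>: "0 < \<kappa>" using P by (simp add: \<kappa>_def prod_pos)
  define \<psi> where "\<psi> = (\<lambda>t x. \<Sum>i<N. \<Sum>j<N. v i * v j * (\<Prod>l\<in>UNIV. D l 0 (x $ l - t * (y $ l) ^ (i + j))))"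
  have yk: "0 \<le> t * (y $ l) ^ k" "t * (y $ l) ^ k \<le> t" if "0 \<le> t" for t l k
  proof -
    have "0 \<le> (y $ l) ^ k" "(y $ l) ^ k \<le> 1"
      using ypos[of l] by (simp_all add: less_imp_le power_le_one)
    then show "0 \<le> t * (y $ l) ^ k" "t * (y $ l) ^ k \<le> t"
      using that by (simp_all add: mult_left_le)
  qed
  \<comment> \<open>\<open>v\<close> removes all terms of the Taylor polynomials but the one of index \<open>\<alpha>\<close>\<close>
  have expansion: "\<bar>\<psi> t x - \<kappa> * t ^ n * L x\<bar> \<le> W * C * t ^ Suc n" if t: "0 < t" "t \<le> t0" for t x
  proof -
    let ?T = "\<lambda>k. \<Prod>l\<in>UNIV. taylor_poly n (D l) (x $ l) (t * (y $ l) ^ k)"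
    have "(\<Sum>i<N. \<Sum>j<N. v i * v j * ?T (i + j))
      = (\<Prod>l\<in>UNIV. (- 1) ^ \<alpha> l * D l (\<alpha> l) (x $ l) / fact (\<alpha> l))
          * t ^ (\<Sum>l\<in>UNIV. \<alpha> l) * (\<Sum>i<N. v i * monomial y \<alpha> ^ i)\<^sup>2"
      unfolding taylor_poly_def
      by (rule quadratic_form_tensor_polynomial) (use v(2) \<alpha>n in auto)
    also have "\<dots> = \<kappa> * t ^ n * L x"
      by (simp add: \<kappa>_def L_def prod_dividef n_def P_def)
    finally have T: "(\<Sum>i<N. \<Sum>j<N. v i * v j * ?T (i + j)) = \<kappa> * t ^ n * L x" .
    have "\<bar>\<psi> t x - \<kappa> * t ^ n * L x\<bar> = \<bar>\<Sum>i<N. \<Sum>j<N. v i * v j *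
       ((\<Prod>l\<in>UNIV. D l 0 (x $ l - t * (y $ l) ^ (i + j))) - ?T (i + j))\<bar>"
      unfolding T[symmetric] \<psi>_def by (simp add: sum_subtractf right_diff_distrib)
    also have "\<dots> \<le> (\<Sum>i<N. \<Sum>j<N. \<bar>v i * v j *
       ((\<Prod>l\<in>UNIV. D l 0 (x $ l - t * (y $ l) ^ (i + j))) - ?T (i + j))\<bar>)"
      by (rule order_trans[OF sum_abs sum_mono[OF sum_abs]])
    also have "\<dots> \<le> (\<Sum>i<N. \<Sum>j<N. \<bar>v i * v j\<bar> * (C * t ^ Suc n))"
      unfolding abs_mult[of "v _ * v _"]
      using t t0 yk[of t] by (intro sum_mono mult_left_mono C[rule_format, where x = "\<lambda>l. x $ l"]) auto
    also have "\<dots> = W * C * t ^ Suc n" unfolding W_def sum_distrib_right by (simp only: mult.assoc)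
    finally show ?thesis .
  qed
  have contD: "continuous_on S (\<lambda>x. D l k (g x))"
    if "k \<le> n" "continuous_on S g" for S k l and g :: "real ^ 'm \<Rightarrow> real"
    using continuous_on_compose2[OF Dcont[OF that(1)] that(2)] by simp
  have cont\<psi>: "continuous_on S (\<psi> t)" and contL: "continuous_on S L" for S t
  proof -
    show "continuous_on S (\<psi> t)"
      unfolding \<psi>_def
      by (intro continuous_on_sum continuous_on_mult continuous_on_const continuous_on_prod contD le0
          continuous_on_diff continuous_on_component continuous_on_id)
    show "continuous_on S L"
      unfolding L_def
      by (intro continuous_on_mult continuous_on_const continuous_on_prod contD \<alpha>n
          continuous_on_component continuous_on_id)
  qed
  \<comment> \<open>moving the shifts back from the bumps to \<open>F\<close> exhibits the quadratic form\<close>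
  have pos: "0 \<le> integral Q (\<lambda>x. F x * \<psi> t x)" if t: "0 < t" "t \<le> t0" for t
  proof -
    define u where "u = (\<lambda>k. (\<chi> l. t * (y $ l) ^ k) :: real ^ 'm)"
    define \<Phi> where "\<Phi> = (\<lambda>x :: real ^ 'm. (\<Prod>l\<in>UNIV. D l 0 (x $ l)))"
    have sub: "cbox (c + u k) (d + u k) \<subseteq> Q" for k
    proof
      fix x assume "x \<in> cbox (c + u k) (d + u k)"
      then have "c $ l + t * (y $ l) ^ k \<le> x $ l \<and> x $ l \<le> d $ l + t * (y $ l) ^ k" for l
        by (simp add: mem_box_cart u_def)
      moreover have "0 \<le> t * (y $ l) ^ k \<and> t * (y $ l) ^ k \<le> t0" for l
        using yk[of t l k] t by linarith
      ultimately have "c $ l \<le> x $ l \<and> x $ l \<le> d $ l + t0" for l by (smt (verit))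
      then show "x \<in> Q" by (simp add: Q_def mem_box_cart)
    qed
    have cont\<Phi>: "continuous_on S \<Phi>" for S
      unfolding \<Phi>_def by (intro continuous_on_prod contD le0 continuous_on_component continuous_on_id)
    have shift: "integral Q (\<lambda>x. F x * \<Phi> (x - u k)) = integral (cbox c d) (\<lambda>x. F (x + u k) * \<Phi> x)" for k
    proof -
      have "F x * \<Phi> (x - u k) = 0" if x: "x \<notin> cbox (c + u k) (d + u k)" for x
      proof -
        obtain l where "\<not> (c $ l \<le> (x - u k) $ l \<and> (x - u k) $ l \<le> d $ l)"
          using x unfolding mem_box_cart vector_add_component vector_minus_component
            le_diff_eq diff_le_eq by blast
        then have "D l 0 ((x - u k) $ l) = 0" by (intro Dsupp) auto
        then have "\<Phi> (x - u k) = 0" unfolding \<Phi>_def by (intro prod_zero) auto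
        then show ?thesis by simp
      qed
      then show ?thesis
        using integral_translated_support[OF sub[of k], where g = "\<lambda>x. F x * \<Phi> (x - u k)"] by simp
    qed
    have contFu: "continuous_on (cbox c d) (\<lambda>x. F (x + u k))" for k
    proof (rule continuous_on_compose2[OF contF])
      show "(\<lambda>x. x + u k) ` cbox c d \<subseteq> Q"
      proof (rule image_subsetI)
        fix x assume "x \<in> cbox c d"
        then have "x + u k \<in> cbox (c + u k) (d + u k)" by (simp add: mem_box_cart)
        then show "x + u k \<in> Q" using sub by blast
      qed
    qed (intro continuous_intros)
    have int1: "(\<lambda>x. v i * v j * (F x * \<Phi> (x - u k))) integrable_on Q" for i j k
      unfolding Q_def
      by (intro integrable_continuous continuous_intros contF[unfolded Q_def]
          continuous_on_compose2[OF cont\<Phi>[of UNIV]]) auto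
    have int2: "(\<lambda>x. v i * v j * (F (x + u k) * \<Phi> x)) integrable_on cbox c d" for i j k
      by (intro integrable_continuous continuous_intros contFu cont\<Phi>)
    have "integral Q (\<lambda>x. F x * \<psi> t x) = integral Q (\<lambda>x. \<Sum>i<N. \<Sum>j<N. v i * v j * (F x * \<Phi> (x - u (i + j))))"
      by (simp add: \<psi>_def \<Phi>_def u_def sum_distrib_left mult_ac)
    also have "\<dots> = (\<Sum>i<N. \<Sum>j<N. v i * v j * integral Q (\<lambda>x. F x * \<Phi> (x - u (i + j))))"
      using int1 by (simp add: integral_sum integrable_sum)
    also have "\<dots> = (\<Sum>i<N. \<Sum>j<N. v i * v j * integral (cbox c d) (\<lambda>x. F (x + u (i + j)) * \<Phi> x))"
      by (simp only: shift)
    also have "\<dots> = integral (cbox c d) (\<lambda>x. \<Sum>i<N. \<Sum>j<N. v i * v j * (F (x + u (i + j)) * \<Phi> x))"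
      using int2 by (simp add: integral_sum integrable_sum)
    also have "\<dots> = integral (cbox c d) (\<lambda>x. (\<Sum>i<N. \<Sum>j<N. v i * v j * F (x + u (i + j))) * \<Phi> x)"
      unfolding sum_distrib_right by (simp only: mult.assoc)
    also have "\<dots> \<ge> 0"
    proof (rule integral_nonneg)
      show "(\<lambda>x. (\<Sum>i<N. \<Sum>j<N. v i * v j * F (x + u (i + j))) * \<Phi> x) integrable_on cbox c d"
        by (intro integrable_continuous continuous_intros contFu cont\<Phi>)
      fix x assume x: "x \<in> cbox c d"
      have "0 \<le> \<Phi> x"
        unfolding \<Phi>_def using D by (intro prod_nonneg) (auto simp: bump_family_def)
      moreover have "0 \<le> (\<Sum>i<N. \<Sum>j<N. v i * v j * F (\<chi> l. x $ l + t * (y $ l) ^ (i + j)))"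
      proof (rule hankel)
        fix l
        have xl: "c $ l \<le> x $ l" "x $ l \<le> d $ l" using x by (auto simp: mem_box_cart)
        then show "0 < x $ l" using c[of l] by linarith
        have "x $ l + t \<le> d $ l + t0" using xl t by simp
        then show "ereal (x $ l + t) < \<rho>" using t0(3)[of l] by (metis ereal_less_eq(3) le_less_trans)
      qed (use v t in auto)
      moreover have "x + u k = (\<chi> l. x $ l + t * (y $ l) ^ k)" for k
        by (simp add: u_def Finite_Cartesian_Product.vec_eq_iff)
      ultimately show "0 \<le> (\<Sum>i<N. \<Sum>j<N. v i * v j * F (x + u (i + j))) * \<Phi> x"
        by (simp add: mult_nonneg_nonneg)
    qed
    finally show ?thesis .
  qed
  have "0 \<le> \<kappa> * integral Q (\<lambda>x. F x * L x)"
  proof (rule linear_dominates_power_nonneg[OF t0(1), of _ n "W * C * integral Q (\<lambda>x. \<bar>F x\<bar>)"])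
    fix t assume t: "0 < t" "t \<le> t0"
    have "integral Q (\<lambda>x. F x * \<psi> t x)
       \<le> integral Q (\<lambda>x. \<kappa> * t ^ n * (F x * L x) + W * C * t ^ Suc n * \<bar>F x\<bar>)"
    proof (rule integral_le)
      fix x
      have "F x * \<psi> t x - \<kappa> * t ^ n * (F x * L x) = F x * (\<psi> t x - \<kappa> * t ^ n * L x)"
        by (simp add: algebra_simps)
      also have "\<dots> \<le> \<bar>F x\<bar> * \<bar>\<psi> t x - \<kappa> * t ^ n * L x\<bar>"
        by (metis abs_ge_self abs_mult)
      also have "\<dots> \<le> \<bar>F x\<bar> * (W * C * t ^ Suc n)"
        by (intro mult_left_mono expansion t) auto
      finally show "F x * \<psi> t x \<le> \<kappa> * t ^ n * (F x * L x) + W * C * t ^ Suc n * \<bar>F x\<bar>"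
        by (simp add: mult_ac)
    qed (unfold Q_def, (intro integrable_continuous continuous_intros cont\<psi> contL contF[unfolded Q_def])+)
    also have "\<dots> = \<kappa> * t ^ n * integral Q (\<lambda>x. F x * L x) + W * C * t ^ Suc n * integral Q (\<lambda>x. \<bar>F x\<bar>)"
      unfolding Q_def
      by (subst integral_add)
        (auto intro!: integrable_continuous continuous_intros contL contF[unfolded Q_def])
    finally show "0 \<le> \<kappa> * integral Q (\<lambda>x. F x * L x) * t ^ n
        + W * C * integral Q (\<lambda>x. \<bar>F x\<bar>) * t ^ Suc n"
      using pos[OF t] by (simp add: mult_ac)
  qed
  then have "0 \<le> integral Q (\<lambda>x. F x * L x)" using \<kappa> by (simp add: zero_le_mult_iff)
  also have "integral Q (\<lambda>x. F x * L x) = integral (cbox c d) (\<lambda>x. F x * L x)"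
  proof -
    have "F x * L x = 0" if x: "x \<notin> cbox c d" for x
    proof -
      obtain l where "\<not> (c $ l \<le> x $ l \<and> x $ l \<le> d $ l)"
        using x unfolding mem_box_cart by blast
      then have "D l (\<alpha> l) (x $ l) = 0" using \<alpha>n by (intro Dsupp) auto
      then have "L x = 0" unfolding L_def by (intro prod_zero) auto
      then show ?thesis by simp
    qed
    moreover have "cbox c d \<subseteq> Q"
    proof
      fix x assume x: "x \<in> cbox c d"
      have "c $ l \<le> x $ l \<and> x $ l \<le> d $ l + t0" for l
        using x t0(1) unfolding mem_box_cart by (meson add_increasing2 less_imp_le)
      then show "x \<in> Q" by (simp add: Q_def mem_box_cart)
    qed
    ultimately show ?thesis
      using integral_translated_support[of c 0 d Q "\<lambda>x. F x * L x"] by simp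
  qed
  finally show ?thesis by (simp add: L_def)
qed

section \<open>Mixed differences are nonnegative\<close>

text \<open>
  The forward difference of order \<open>\<alpha> l\<close> in the coordinate \<open>l\<close>, for all \<open>l\<close> at once, with step \<open>h\<close>.
\<close>

definition mixed_difference :: "(real ^ 'm::finite \<Rightarrow> real) \<Rightarrow> ('m \<Rightarrow> nat) \<Rightarrow> real \<Rightarrow> real ^ 'm \<Rightarrow> real" where
  "mixed_difference F \<alpha> h a =
    (\<Sum>j | \<forall>l. j l \<le> \<alpha> l. (\<Prod>l\<in>UNIV. (-1) ^ (\<alpha> l - j l) * real (\<alpha> l choose j l)) * F (\<chi> l. a $ l + h * real (j l)))"

text \<open>
  Suppose the difference is negative at \<open>a\<close>, hence on a small box \<open>[a, b]\<close>. Choose bumps \<open>X l\<close> on the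
  sides of this box and average each one \<open>\<alpha> l\<close> times over windows of length \<open>h\<close>. The \<open>\<alpha> l\<close>-th
  derivative of the result is a backward difference of \<open>X l\<close>, so \<open>weak_derivative_nonneg\<close> says that
  the integral of \<open>mixed_difference F \<alpha> h\<close> against the product of the \<open>X l\<close> is nonnegative; but its
  integrand is nonpositive and negative somewhere.
\<close>

lemma mixed_difference_nonneg:
  fixes y :: "real ^ 'm::finite" and F :: "real ^ 'm \<Rightarrow> real" and \<alpha> :: "'m \<Rightarrow> nat"
  assumes y: "y \<in> Y_set"
    and cont: "continuous_on (open_cube \<rho>) F"
    and hankel: "\<And>N v t a. 1 \<le> N \<Longrightarrow> (\<And>l. 0 < a $ l) \<Longrightarrow> 0 \<le> t \<Longrightarrow> (\<And>l. ereal (a $ l + t) < \<rho>) \<Longrightarrow>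
       0 \<le> (\<Sum>i<N. \<Sum>j<N. v i * v j * F (\<chi> l. a $ l + t * (y $ l) ^ (i + j)))"
    and h: "0 < h" and a: "\<And>l. 0 < a $ l" and ah: "\<And>l. ereal (a $ l + h * real (\<alpha> l)) < \<rho>"
  shows "0 \<le> mixed_difference F \<alpha> h a"
proof (rule ccontr)
  assume neg: "\<not> 0 \<le> mixed_difference F \<alpha> h a"
  let ?B = "{j :: 'm \<Rightarrow> nat. \<forall>l. j l \<le> \<alpha> l}"
  let ?w = "\<lambda>j :: 'm \<Rightarrow> nat. \<Prod>l\<in>UNIV. (-1) ^ (\<alpha> l - j l) * real (\<alpha> l choose j l)"
  define u where "u = (\<lambda>j :: 'm \<Rightarrow> nat. (\<chi> l. h * real (j l)) :: real ^ 'm)"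
  have md: "mixed_difference F \<alpha> h x = (\<Sum>j\<in>?B. ?w j * F (x + u j))" for x
    unfolding mixed_difference_def
    by (intro sum.cong refl arg_cong2[where f = "(*)"] arg_cong[where f = F]) (simp add: u_def Finite_Cartesian_Product.vec_eq_iff)
  have in_cube: "x + u j \<in> open_cube \<rho>"
    if "j \<in> ?B" "\<And>l. 0 < x $ l" "\<And>l. ereal (x $ l + h * real (\<alpha> l)) < \<rho>" for x j
    unfolding mem_open_cube_iff
  proof (intro allI conjI)
    fix l
    show "0 < (x + u j) $ l" using that(2)[of l] h by (simp add: u_def add_pos_nonneg)
    have "(x + u j) $ l \<le> x $ l + h * real (\<alpha> l)" using that(1) h by (simp add: u_def)
    then show "ereal ((x + u j) $ l) < \<rho>" using that(3)[of l] by (metis ereal_less_eq(3) le_less_trans)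
  qed
  have "isCont (mixed_difference F \<alpha> h) a"
  proof -
    have "isCont (\<lambda>x. F (x + u j)) a" if "j \<in> ?B" for j
    proof (rule isCont_o2[where g = F])
      show "isCont F (a + u j)"
        using cont in_cube[OF that a ah] by (simp add: continuous_on_eq_continuous_at[OF open_open_cube])
    qed (intro continuous_intros)
    then show ?thesis unfolding md[abs_def] by (intro continuous_intros) auto
  qed
  then have "(mixed_difference F \<alpha> h \<longlongrightarrow> mixed_difference F \<alpha> h a) (nhds a)"
    by (simp only: isCont_def tendsto_at_iff_tendsto_nhds)
  then have "\<forall>\<^sub>F x in nhds a. mixed_difference F \<alpha> h x < 0"
    by (rule order_tendstoD(2)) (use neg in simp)
  moreover have "\<forall>\<^sub>F x in nhds a. \<forall>l. ereal (x $ l + h * real (\<alpha> l)) < \<rho>"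
  proof (rule eventually_all_finite)
    fix l
    have "((\<lambda>x. ereal (x $ l + h * real (\<alpha> l))) \<longlongrightarrow> ereal (a $ l + h * real (\<alpha> l))) (nhds a)"
      by (intro tendsto_intros filterlim_ident)
    then show "\<forall>\<^sub>F x in nhds a. ereal (x $ l + h * real (\<alpha> l)) < \<rho>"
      using ah[of l] by (rule order_tendstoD)
  qed
  ultimately have "\<forall>\<^sub>F x in nhds a. mixed_difference F \<alpha> h x < 0 \<and> (\<forall>l. ereal (x $ l + h * real (\<alpha> l)) < \<rho>)"
    by (rule eventually_conj)
  then obtain e where e: "0 < e" "\<And>x. dist x a < e \<Longrightarrow> mixed_difference F \<alpha> h x < 0"
      "\<And>x l. dist x a < e \<Longrightarrow> ereal (x $ l + h * real (\<alpha> l)) < \<rho>"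
    unfolding eventually_nhds_metric by blast
  \<comment> \<open>the sum of the side lengths of \<open>[a, b]\<close> is \<open>e / 2\<close>, so the box lies in the ball of radius \<open>e\<close>\<close>
  define r where "r = e / (2 * real CARD('m))"
  have r: "0 < r" using e(1) by (simp add: r_def)
  define b where "b = a + (\<chi> l. r)"
  have near: "dist x a < e" if "x \<in> cbox a b" for x
  proof -
    have "dist x a \<le> (\<Sum>l\<in>UNIV. \<bar>(x - a) $ l\<bar>)"
      unfolding dist_norm by (rule norm_le_l1_cart)
    also have "\<dots> \<le> (\<Sum>l\<in>(UNIV :: 'm set). r)"
      using that by (intro sum_mono) (auto simp: b_def mem_box_cart algebra_simps)
    also have "\<dots> < e" using e(1) by (simp add: r_def)
    finally show ?thesis .
  qed
  define n where "n = (\<Sum>l\<in>UNIV. \<alpha> l)"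
  have "\<exists>X. bump_family (Suc n) (a $ l) (b $ l) X" for l
  proof -
    have "a $ l < b $ l" using r by (simp add: b_def)
    then show ?thesis by (rule bump_family_exists) blast
  qed
  then obtain X where X: "\<And>l. bump_family (Suc n) (a $ l) (b $ l) (X l)" by metis
  have "\<exists>E. bump_family (Suc n + \<alpha> l) (a $ l) (b $ l + real (\<alpha> l) * h) E \<and>
    (\<forall>x. E (\<alpha> l) x = (\<Sum>j\<le>\<alpha> l. (-1) ^ j * real (\<alpha> l choose j) * X l 0 (x - real j * h)))" for l
    by (rule bump_family_iterated_average[OF X h]) blast
  then obtain E where E: "\<And>l. bump_family (Suc n + \<alpha> l) (a $ l) (b $ l + real (\<alpha> l) * h) (E l)"
    "\<And>l x. E l (\<alpha> l) x = (\<Sum>j\<le>\<alpha> l. (-1) ^ j * real (\<alpha> l choose j) * X l 0 (x - real j * h))" by metis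
  define d where "d = b + u \<alpha>"
  have d: "ereal (d $ l) < \<rho>" for l
  proof -
    have "b \<in> cbox a b" using r by (simp add: b_def mem_box_cart)
    then show ?thesis using e(3)[OF near, of b l] by (simp add: d_def u_def)
  qed
  have dl: "d $ l = b $ l + real (\<alpha> l) * h" for l by (simp add: d_def u_def)
  have "0 \<le> integral (cbox a d) (\<lambda>x. F x * (\<Prod>l\<in>UNIV. (-1) ^ \<alpha> l * E l (\<alpha> l) (x $ l)))"
    using E(1) by (intro weak_derivative_nonneg[OF y cont hankel, where M = "\<lambda>l. Suc n + \<alpha> l"] a d)
      (auto simp: dl n_def)
  also have "\<dots> = integral (cbox a b) (\<lambda>x. mixed_difference F \<alpha> h x * (\<Prod>l\<in>UNIV. X l 0 (x $ l)))"
  proof -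
    define \<Phi> where "\<Phi> = (\<lambda>x :: real ^ 'm. (\<Prod>l\<in>UNIV. X l 0 (x $ l)))"
    have Xcont: "continuous_on UNIV (X l 0)" for l using X[of l] by (auto simp: bump_family_def)
    have cont\<Phi>: "continuous_on S \<Phi>" for S
      unfolding \<Phi>_def by (auto intro!: continuous_intros continuous_on_compose2[OF Xcont])
    have sub: "cbox (a + u j) (b + u j) \<subseteq> cbox a d" if "j \<in> ?B" for j
    proof
      fix x assume x: "x \<in> cbox (a + u j) (b + u j)"
      have "0 \<le> u j $ l \<and> u j $ l \<le> u \<alpha> $ l" for l using that h by (simp add: u_def)
      then show "x \<in> cbox a d" using x
        unfolding d_def mem_box_cart vector_add_component
        by (meson add_left_mono le_add_same_cancel1 order_trans)
    qed
    have expand: "(\<Prod>l\<in>UNIV. (-1) ^ \<alpha> l * E l (\<alpha> l) (x $ l)) = (\<Sum>j\<in>?B. ?w j * \<Phi> (x - u j))" for x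
    proof -
      have sgn: "(-1) ^ \<alpha> l * ((-1) ^ j :: real) = (-1) ^ (\<alpha> l - j)" if "j \<le> \<alpha> l" for j l
      proof -
        have "(-1 :: real) ^ \<alpha> l = (-1) ^ (\<alpha> l - j) * (-1) ^ j"
          using that by (simp flip: power_add)
        then show ?thesis by (simp add: mult.assoc flip: power_mult_distrib)
      qed
      have "(-1) ^ \<alpha> l * E l (\<alpha> l) (x $ l)
        = (\<Sum>j\<le>\<alpha> l. (-1) ^ (\<alpha> l - j) * real (\<alpha> l choose j) * X l 0 (x $ l - h * real j))" for l
        unfolding E(2) sum_distrib_left
        by (intro sum.cong refl) (simp add: sgn[symmetric] mult_ac)
      then show ?thesis
        unfolding prod_sum_le_fun by (simp add: prod_sum_le_fun prod.distrib \<Phi>_def u_def)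
    qed
    have shift: "integral (cbox a d) (\<lambda>x. F x * \<Phi> (x - u j)) = integral (cbox a b) (\<lambda>x. F (x + u j) * \<Phi> x)"
      if j: "j \<in> ?B" for j
    proof -
      have "F x * \<Phi> (x - u j) = 0" if x: "x \<notin> cbox (a + u j) (b + u j)" for x
      proof -
        obtain l where "\<not> (a $ l \<le> (x - u j) $ l \<and> (x - u j) $ l \<le> b $ l)"
          using x unfolding mem_box_cart vector_add_component vector_minus_component
            le_diff_eq diff_le_eq by blast
        then have "X l 0 ((x - u j) $ l) = 0" using X[of l] by (auto simp: bump_family_def)
        then have "\<Phi> (x - u j) = 0" unfolding \<Phi>_def by (intro prod_zero) auto
        then show ?thesis by simp
      qed
      then show ?thesis
        using integral_translated_support[OF sub[OF j], of "\<lambda>x. F x * \<Phi> (x - u j)"] by simp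
    qed
    have contF: "continuous_on (cbox a d) F"
    proof (rule continuous_on_subset[OF cont], rule subsetI, unfold mem_open_cube_iff, intro allI conjI)
      fix x l assume "x \<in> cbox a d"
      then have xl: "a $ l \<le> x $ l" "x $ l \<le> d $ l" by (auto simp: mem_box_cart)
      then show "0 < x $ l" using a[of l] by linarith
      show "ereal (x $ l) < \<rho>" using xl d[of l] by (metis ereal_less_eq(3) le_less_trans)
    qed
    have contFu: "continuous_on (cbox a b) (\<lambda>x. F (x + u j))" if "j \<in> ?B" for j
    proof (rule continuous_on_compose2[OF contF])
      show "(\<lambda>x. x + u j) ` cbox a b \<subseteq> cbox a d"
        using sub[OF that] by (auto simp: mem_box_cart)
    qed (intro continuous_intros)
    have "integral (cbox a d) (\<lambda>x. F x * (\<Prod>l\<in>UNIV. (-1) ^ \<alpha> l * E l (\<alpha> l) (x $ l)))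
      = integral (cbox a d) (\<lambda>x. \<Sum>j\<in>?B. ?w j * (F x * \<Phi> (x - u j)))"
      unfolding expand by (simp add: sum_distrib_left mult_ac)
    also have "\<dots> = (\<Sum>j\<in>?B. ?w j * integral (cbox a d) (\<lambda>x. F x * \<Phi> (x - u j)))"
      by (subst integral_sum) (auto intro!: integrable_continuous continuous_intros contF
          continuous_on_compose2[OF cont\<Phi>[of UNIV]] finite_Collect_le_fun)
    also have "\<dots> = (\<Sum>j\<in>?B. ?w j * integral (cbox a b) (\<lambda>x. F (x + u j) * \<Phi> x))"
      using shift by (intro sum.cong refl) auto
    also have "\<dots> = integral (cbox a b) (\<lambda>x. \<Sum>j\<in>?B. ?w j * (F (x + u j) * \<Phi> x))"
      by (subst integral_sum) (auto intro!: integrable_continuous continuous_intros contFu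
          cont\<Phi> finite_Collect_le_fun)
    also have "\<dots> = integral (cbox a b) (\<lambda>x. mixed_difference F \<alpha> h x * \<Phi> x)"
      unfolding md sum_distrib_right by (simp only: mult.assoc)
    finally show ?thesis by (simp add: \<Phi>_def)
  qed
  finally have nonneg: "0 \<le> integral (cbox a b) (\<lambda>x. mixed_difference F \<alpha> h x * (\<Prod>l\<in>UNIV. X l 0 (x $ l)))" .
  define f where "f = (\<lambda>x. - (mixed_difference F \<alpha> h x * (\<Prod>l\<in>UNIV. X l 0 (x $ l))))"
  have Xnn: "0 \<le> X l 0 x" for l x using X[of l] by (auto simp: bump_family_def)
  have f_nonneg: "0 \<le> f x" if "x \<in> cbox a b" for x
    unfolding f_def using e(2)[OF near[OF that]] Xnn
    by (simp add: mult_nonpos_nonneg prod_nonneg)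
  have contf: "continuous_on (cbox a b) f"
  proof -
    have Xcont: "continuous_on UNIV (X l 0)" for l using X[of l] by (auto simp: bump_family_def)
    have "continuous_on (cbox a b) (\<lambda>x. F (x + u j))" if "j \<in> ?B" for j
    proof (rule continuous_on_compose2[OF cont])
      show "(\<lambda>x. x + u j) ` cbox a b \<subseteq> open_cube \<rho>"
      proof (rule image_subsetI)
        fix x assume x: "x \<in> cbox a b"
        have "0 < x $ l" for l using x a[of l] by (auto simp: mem_box_cart intro: less_le_trans)
        then show "x + u j \<in> open_cube \<rho>" using e(3)[OF near[OF x]] that by (intro in_cube) auto
      qed
    qed (intro continuous_intros)
    then show ?thesis
      unfolding f_def md by (auto intro!: continuous_intros continuous_on_compose2[OF Xcont])
  qed
  have "integral (cbox a b) f \<le> 0" using nonneg by (simp add: f_def)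
  moreover have "0 \<le> integral (cbox a b) f"
    using contf f_nonneg by (intro integral_nonneg integrable_continuous) auto
  ultimately have "integral (cbox a b) f = 0" by simp
  moreover have "box a b \<noteq> {}" using r by (simp add: interval_ne_empty_cart b_def)
  ultimately have f0: "f x = 0" if "x \<in> cbox a b" for x
    using integral_cbox_eq_0_iff[OF contf] f_nonneg that by blast
  have "\<forall>l. \<exists>x. 0 < X l 0 x" using X by (auto simp: bump_family_def)
  then obtain x where x: "\<And>l. 0 < X l 0 (x l)" by metis
  have "x l \<in> {a $ l..b $ l}" for l
    using X[of l] x[of l] unfolding bump_family_def by (metis less_irrefl le0)
  then have "(\<chi> l. x l) \<in> cbox a b" by (simp add: mem_box_cart)
  then show False
    using f0[of "\<chi> l. x l"] e(2)[OF near, of "\<chi> l. x l"] x by (simp add: f_def order_less_irrefl)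
      (metis less_irrefl)
qed

section \<open>Bernstein polynomials of several variables\<close>

text \<open>
  For nonnegative \<open>w\<close> these are the total mass of a product distribution on the grid and the
  expectation of a function of one coordinate, which depends on the distribution of that coordinate alone.
\<close>

lemma sum_le_fun_prod_weight:
  fixes w :: "'m::finite \<Rightarrow> nat \<Rightarrow> real"
  assumes one: "\<And>l. (\<Sum>i\<le>n. w l i) = 1"
  shows "(\<Sum>j | \<forall>l. j l \<le> n. \<Prod>l\<in>UNIV. w l (j l)) = 1"
    and "(\<Sum>j | \<forall>l. j l \<le> n. g (j k) * (\<Prod>l\<in>UNIV. w l (j l))) = (\<Sum>i\<le>n. g i * w k i)"
proof -
  show "(\<Sum>j | \<forall>l. j l \<le> n. \<Prod>l\<in>UNIV. w l (j l)) = 1"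
    using prod_sum_le_fun[of w "\<lambda>_. n"] by (simp add: one)
  let ?w = "\<lambda>l i. (if l = k then g i else 1) * w l i"
  have "g (j k) * (\<Prod>l\<in>UNIV. w l (j l)) = (\<Prod>l\<in>UNIV. ?w l (j l))" for j
    unfolding prod.distrib by (subst prod.delta) auto
  then have "(\<Sum>j | \<forall>l. j l \<le> n. g (j k) * (\<Prod>l\<in>UNIV. w l (j l)))
    = (\<Sum>j | \<forall>l. j l \<le> n. \<Prod>l\<in>UNIV. ?w l (j l))" by simp
  also have "\<dots> = (\<Prod>l\<in>UNIV. \<Sum>i\<le>n. ?w l i)"
    by (rule prod_sum_le_fun[where \<alpha> = "\<lambda>_. n", symmetric])
  also have "\<dots> = (\<Prod>l\<in>UNIV. if l = k then \<Sum>i\<le>n. g i * w k i else 1)"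
    by (intro prod.cong) (auto simp: one)
  also have "\<dots> = (\<Sum>i\<le>n. g i * w k i)" by (subst prod.delta) auto
  finally show "(\<Sum>j | \<forall>l. j l \<le> n. g (j k) * (\<Prod>l\<in>UNIV. w l (j l))) = (\<Sum>i\<le>n. g i * w k i)" .
qed

lemma sum_Bernstein_variance:
  assumes n: "0 < n"
  shows "(\<Sum>k\<le>n. (x - real k / real n)\<^sup>2 * Bernstein n k x) = x * (1 - x) / real n"
proof -
  let ?n = "real n"
  have "(x - real k / ?n)\<^sup>2 * Bernstein n k x
      = (real k * (real k - 1) * Bernstein n k x + (1 - 2 * ?n * x) * (real k * Bernstein n k x)
         + (?n * x)\<^sup>2 * Bernstein n k x) / ?n\<^sup>2" for k
    using n by (simp add: field_simps power2_eq_square)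
  then have "(\<Sum>k\<le>n. (x - real k / ?n)\<^sup>2 * Bernstein n k x)
      = (?n * (?n - 1) * x\<^sup>2 + (1 - 2 * ?n * x) * (?n * x) + (?n * x)\<^sup>2) / ?n\<^sup>2"
    by (simp only: sum.distrib flip: sum_divide_distrib sum_distrib_left)
      (simp only: sum_kk_Bernstein sum_k_Bernstein sum_Bernstein mult_1_right)
  also have "\<dots> = x * (1 - x) / ?n"
    using n by (simp add: field_simps power2_eq_square)
  finally show ?thesis .
qed

text \<open>
  Bernstein's proof: \<open>f\<close> varies by at most \<open>e / 2\<close> at distances below \<open>d\<close>, and elsewhere
  \<open>2 M \<le> 2 M (distance / d)\<^sup>2\<close>; the expected squared distance is at most \<open>m / n\<close>, where \<open>m\<close> is the
  dimension, as each coordinate has variance at most \<open>1 / n\<close>.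
\<close>

lemma multivariate_Bernstein_approximation:
  fixes f :: "real ^ 'm::finite \<Rightarrow> real"
  assumes contf: "continuous_on (cbox 0 1) f" and e: "0 < e"
  obtains n where "0 < n" "\<And>x. x \<in> cbox 0 1 \<Longrightarrow>
    \<bar>f x - (\<Sum>j | \<forall>l. j l \<le> n. f (\<chi> l. real (j l) / real n) * (\<Prod>l\<in>UNIV. Bernstein n (j l) (x $ l)))\<bar> < e"
proof -
  have cpt: "compact (cbox 0 (1 :: real ^ 'm))" by simp
  have "bounded (f ` cbox 0 1)"
    using contf cpt by (intro compact_imp_bounded compact_continuous_image)
  then obtain M where M: "\<And>x. x \<in> cbox 0 1 \<Longrightarrow> \<bar>f x\<bar> \<le> M"
    unfolding bounded_real by blast
  have "0 \<in> cbox 0 (1 :: real ^ 'm)" by (simp add: mem_box_cart)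
  then have M0: "0 \<le> M" using M by (meson abs_ge_zero order_trans)
  have "uniformly_continuous_on (cbox 0 1) f"
    using compact_uniformly_continuous contf cpt by blast
  then obtain d where d: "0 < d"
    "\<And>x z. x \<in> cbox 0 1 \<Longrightarrow> z \<in> cbox 0 1 \<Longrightarrow> dist z x < d \<Longrightarrow> dist (f z) (f x) < e / 2"
    using e unfolding uniformly_continuous_on_def by (meson half_gt_zero)
  obtain n :: nat where n: "4 * M * real CARD('m) / (d\<^sup>2 * e) < real n" using reals_Archimedean2 by blast
  have "0 \<le> 4 * M * real CARD('m) / (d\<^sup>2 * e)" using M0 d e by simp
  then have n0: "0 < n" using n by (metis not_less of_nat_0 of_nat_0_less_iff order_le_less_trans)
  have "\<bar>f x - (\<Sum>j | \<forall>l. j l \<le> n. f (\<chi> l. real (j l) / real n) * (\<Prod>l\<in>UNIV. Bernstein n (j l) (x $ l)))\<bar> < e"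
    if x: "x \<in> cbox 0 1" for x
  proof -
    let ?B = "{j :: 'm \<Rightarrow> nat. \<forall>l. j l \<le> n}"
    define W where "W = (\<lambda>j. \<Prod>l\<in>UNIV. Bernstein n (j l) (x $ l))"
    define p where "p = (\<lambda>j :: 'm \<Rightarrow> nat. (\<chi> l. real (j l) / real n) :: real ^ 'm)"
    have xl: "0 \<le> x $ l" "x $ l \<le> 1" for l using x by (auto simp: mem_box_cart)
    have W0: "0 \<le> W j" for j
      unfolding W_def using xl by (intro prod_nonneg) (auto simp: Bernstein_nonneg)
    have W1: "(\<Sum>j\<in>?B. W j) = 1"
      unfolding W_def by (rule sum_le_fun_prod_weight) simp
    have var: "(\<Sum>j\<in>?B. (x $ k - real (j k) / real n)\<^sup>2 * W j) \<le> 1 / real n" for k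
    proof -
      have "(\<Sum>j\<in>?B. (x $ k - real (j k) / real n)\<^sup>2 * W j) = x $ k * (1 - x $ k) / real n"
        unfolding W_def
        by (subst sum_le_fun_prod_weight(2)[where g = "\<lambda>i. (x $ k - real i / real n)\<^sup>2"])
          (simp_all add: sum_Bernstein_variance n0)
      also have "\<dots> \<le> 1 / real n"
        using xl[of k] n0 by (intro divide_right_mono) (auto simp: mult_le_one)
      finally show ?thesis .
    qed
    have diff: "\<bar>f x - f (p j)\<bar> \<le> e / 2 + 2 * M / d\<^sup>2 * (\<Sum>l\<in>UNIV. (x $ l - real (j l) / real n)\<^sup>2)"
      if j: "j \<in> ?B" for j
    proof -
      have pj: "p j \<in> cbox 0 1" using j n0 by (auto simp: p_def mem_box_cart)
      have dist2: "(dist x (p j))\<^sup>2 = (\<Sum>l\<in>UNIV. (x $ l - real (j l) / real n)\<^sup>2)"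
        unfolding dist_norm power2_norm_eq_inner inner_vec_def by (simp add: p_def power2_eq_square)
      show ?thesis
      proof (cases "dist x (p j) < d")
        case True
        have "\<bar>f x - f (p j)\<bar> < e / 2"
          using d(2)[OF pj x True] by (simp add: dist_real_def)
        moreover have "0 \<le> 2 * M / d\<^sup>2 * (\<Sum>l\<in>UNIV. (x $ l - real (j l) / real n)\<^sup>2)"
          using M0 by (intro mult_nonneg_nonneg sum_nonneg) auto
        ultimately show ?thesis by linarith
      next
        case False
        have "d\<^sup>2 \<le> (dist x (p j))\<^sup>2" using False d(1) by (intro power_mono) auto
        then have "2 * M * 1 \<le> 2 * M * ((dist x (p j))\<^sup>2 / d\<^sup>2)"
          using M0 d(1) by (intro mult_left_mono) auto
        moreover have "\<bar>f x - f (p j)\<bar> \<le> 2 * M" using M[OF x] M[OF pj] by linarith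
        ultimately show ?thesis using e by (simp add: dist2)
      qed
    qed
    have "(\<Sum>j\<in>?B. (f x - f (p j)) * W j) = f x * (\<Sum>j\<in>?B. W j) - (\<Sum>j\<in>?B. f (p j) * W j)"
      by (simp only: left_diff_distrib sum_subtractf sum_distrib_left)
    then have "f x - (\<Sum>j\<in>?B. f (p j) * W j) = (\<Sum>j\<in>?B. (f x - f (p j)) * W j)"
      by (simp only: W1 mult_1_right)
    then have "\<bar>f x - (\<Sum>j\<in>?B. f (p j) * W j)\<bar> \<le> (\<Sum>j\<in>?B. \<bar>(f x - f (p j)) * W j\<bar>)"
      by (simp only: sum_abs)
    also have "\<dots> \<le> (\<Sum>j\<in>?B. (e / 2 + 2 * M / d\<^sup>2 * (\<Sum>l\<in>UNIV. (x $ l - real (j l) / real n)\<^sup>2)) * W j)"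
      unfolding abs_mult abs_of_nonneg[OF W0] using diff W0 by (intro sum_mono mult_right_mono) auto
    also have "\<dots> = e / 2 * (\<Sum>j\<in>?B. W j)
        + 2 * M / d\<^sup>2 * (\<Sum>j\<in>?B. (\<Sum>l\<in>UNIV. (x $ l - real (j l) / real n)\<^sup>2) * W j)"
      by (simp only: distrib_right sum.distrib mult.assoc flip: sum_distrib_left)
    also have "(\<Sum>j\<in>?B. (\<Sum>l\<in>UNIV. (x $ l - real (j l) / real n)\<^sup>2) * W j)
        = (\<Sum>j\<in>?B. \<Sum>l\<in>UNIV. (x $ l - real (j l) / real n)\<^sup>2 * W j)"
      by (simp only: sum_distrib_right)
    also have "(\<Sum>j\<in>?B. \<Sum>l\<in>UNIV. (x $ l - real (j l) / real n)\<^sup>2 * W j)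
        = (\<Sum>l\<in>UNIV. \<Sum>j\<in>?B. (x $ l - real (j l) / real n)\<^sup>2 * W j)"
      by (rule sum.swap)
    also have "e / 2 * (\<Sum>j\<in>?B. W j) + 2 * M / d\<^sup>2 * \<dots> \<le> e / 2 * 1 + 2 * M / d\<^sup>2 * (\<Sum>l\<in>(UNIV :: 'm set). 1 / real n)"
      unfolding W1 using var M0 by (intro add_left_mono mult_left_mono sum_mono) auto
    also have "\<dots> < e"
      using n d(1) e n0 by (simp add: field_simps)
    finally show ?thesis unfolding W_def p_def .
  qed
  then show ?thesis using that n0 by blast
qed

text \<open>
  The sum runs over all \<open>k \<le> n\<close>, so that its range is the same for every \<open>j\<close>; the terms with
  \<open>k < j\<close> vanish.
\<close>

lemma Bernstein_monomial_expansion: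
  assumes j: "j \<le> n"
  shows "Bernstein n j x = (\<Sum>k\<le>n. real (n choose k) * ((-1) ^ (k - j) * real (k choose j)) * x ^ k)"
proof -
  have "(\<Sum>k\<le>n. real (n choose k) * ((-1) ^ (k - j) * real (k choose j)) * x ^ k)
     = (\<Sum>k\<in>{j..n}. real (n choose k) * ((-1) ^ (k - j) * real (k choose j)) * x ^ k)"
    by (intro sum.mono_neutral_right) (auto simp: not_le binomial_eq_0)
  also have "\<dots> = (\<Sum>i\<le>n - j. real (n choose (i + j)) * ((-1) ^ i * real ((i + j) choose j)) * x ^ (i + j))"
    using j sum.shift_bounds_cl_nat_ivl[of "\<lambda>k. real (n choose k) * ((-1) ^ (k - j) * real (k choose j)) * x ^ k" 0 j "n - j"]
    by (simp add: atLeast0AtMost)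
  also have "\<dots> = (\<Sum>i\<le>n - j. real (n choose j) * x ^ j * (real ((n - j) choose i) * (- x) ^ i))"
  proof (intro sum.cong refl)
    fix i assume "i \<in> {..n - j}"
    then have "(n choose (i + j)) * ((i + j) choose j) = (n choose j) * ((n - j) choose i)"
      using j choose_mult[of j "i + j" n] by simp
    then have "real (n choose (i + j)) * real ((i + j) choose j) = real (n choose j) * real ((n - j) choose i)"
      by (metis of_nat_mult)
    then show "real (n choose (i + j)) * ((-1) ^ i * real ((i + j) choose j)) * x ^ (i + j)
        = real (n choose j) * x ^ j * (real ((n - j) choose i) * (- x) ^ i)"
      by (simp add: power_add power_minus[of x] mult_ac)
  qed
  also have "\<dots> = real (n choose j) * x ^ j * (- x + 1) ^ (n - j)"
    unfolding binomial_ring by (simp add: sum_distrib_left)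
  finally show ?thesis by (simp add: Bernstein_def)
qed

text \<open>
  The reason for using Bernstein polynomials: their coefficients are positive multiples of mixed differences.
\<close>

lemma multivariate_Bernstein_eq_mixed_differences:
  fixes f :: "real ^ 'm::finite \<Rightarrow> real"
  shows "(\<Sum>j | \<forall>l. j l \<le> n. f (\<chi> l. real (j l) / real n) * (\<Prod>l\<in>UNIV. Bernstein n (j l) (x $ l)))
    = (\<Sum>k | \<forall>l. k l \<le> n. (\<Prod>l\<in>UNIV. real (n choose k l)) * mixed_difference f k (1 / real n) 0 * monomial x k)"
proof -
  let ?B = "{j :: 'm \<Rightarrow> nat. \<forall>l. j l \<le> n}"
  let ?f = "\<lambda>j :: 'm \<Rightarrow> nat. f (\<chi> l. real (j l) / real n)"
  let ?w = "\<lambda>(k :: 'm \<Rightarrow> nat) (j :: 'm \<Rightarrow> nat). \<Prod>l\<in>UNIV. (-1) ^ (k l - j l) * real (k l choose j l)"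
  let ?b = "\<lambda>k :: 'm \<Rightarrow> nat. \<Prod>l\<in>UNIV. real (n choose k l)"
  have "(\<Prod>l\<in>UNIV. Bernstein n (j l) (x $ l)) = (\<Sum>k\<in>?B. ?b k * ?w k j * monomial x k)"
    if "j \<in> ?B" for j
  proof -
    have "(\<Prod>l\<in>UNIV. Bernstein n (j l) (x $ l)) = (\<Prod>l\<in>UNIV. \<Sum>k\<le>n.
        real (n choose k) * ((-1) ^ (k - j l) * real (k choose j l)) * (x $ l) ^ k)"
      using that by (intro prod.cong refl Bernstein_monomial_expansion) auto
    also have "\<dots> = (\<Sum>k\<in>?B. ?b k * ?w k j * monomial x k)"
      unfolding prod_sum_le_fun monomial_def by (simp only: prod.distrib)
    finally show ?thesis .
  qed
  then have "(\<Sum>j\<in>?B. ?f j * (\<Prod>l\<in>UNIV. Bernstein n (j l) (x $ l)))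
      = (\<Sum>j\<in>?B. ?f j * (\<Sum>k\<in>?B. ?b k * ?w k j * monomial x k))"
    by (intro sum.cong refl) auto
  also have "\<dots> = (\<Sum>j\<in>?B. \<Sum>k\<in>?B. ?b k * (?w k j * ?f j) * monomial x k)"
    unfolding sum_distrib_left by (simp only: mult_ac)
  also have "\<dots> = (\<Sum>k\<in>?B. \<Sum>j\<in>?B. ?b k * (?w k j * ?f j) * monomial x k)"
    by (rule sum.swap)
  also have "\<dots> = (\<Sum>k\<in>?B. ?b k * (\<Sum>j\<in>?B. ?w k j * ?f j) * monomial x k)"
    unfolding sum_distrib_left sum_distrib_right ..
  also have "\<dots> = (\<Sum>k\<in>?B. ?b k * mixed_difference f k (1 / real n) 0 * monomial x k)"
  proof (intro sum.cong refl)
    fix k assume k: "k \<in> ?B"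
    have "?w k j = 0" if "\<not> (\<forall>l. j l \<le> k l)" for j
      using that by (auto simp: not_le intro!: prod_zero)
    then have "(\<Sum>j\<in>?B. ?w k j * ?f j) = (\<Sum>j | \<forall>l. j l \<le> k l. ?w k j * ?f j)"
      using k finite_Collect_le_fun[of "\<lambda>_. n"]
      by (intro sum.mono_neutral_right) (auto intro: order_trans)
    then show "?b k * (\<Sum>j\<in>?B. ?w k j * ?f j) * monomial x k
        = ?b k * mixed_difference f k (1 / real n) 0 * monomial x k"
      by (simp add: mixed_difference_def)
  qed
  finally show ?thesis .
qed

text \<open>
  The Bernstein polynomials live on a closed cube, while \<open>F\<close> is given on an open one. The
  translation by \<open>\<epsilon>\<close> moves the corner \<open>0\<close> into the domain of \<open>F\<close>.
\<close>

lemma nonneg_polynomial_approximation: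
  fixes F :: "real ^ 'm::finite \<Rightarrow> real"
  assumes cont: "continuous_on (open_cube \<rho>) F"
    and diff: "\<And>\<alpha> h a. 0 < h \<Longrightarrow> (\<And>l. 0 < a $ l) \<Longrightarrow> (\<And>l. ereal (a $ l + h * real (\<alpha> l)) < \<rho>) \<Longrightarrow>
      0 \<le> mixed_difference F \<alpha> h a"
    and R: "0 < R" and \<epsilon>: "0 < \<epsilon>" and \<epsilon>R: "ereal (\<epsilon> + R) < \<rho>" and \<eta>: "0 < \<eta>"
  shows "\<exists>n c. (\<forall>k. (\<forall>l. k l \<le> n) \<longrightarrow> 0 \<le> c k) \<and> (\<forall>x. (\<forall>l. 0 \<le> x $ l \<and> x $ l \<le> R) \<longrightarrow>
    \<bar>F (\<chi> l. \<epsilon> + x $ l) - (\<Sum>k | \<forall>l. k l \<le> n. c k * monomial x k)\<bar> < \<eta>)"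
proof -
  define f where "f = (\<lambda>u :: real ^ 'm. F (\<chi> l. \<epsilon> + R * u $ l))"
  have "continuous_on (cbox 0 1) f"
    unfolding f_def
  proof (rule continuous_on_compose2[OF cont])
    show "continuous_on (cbox 0 1) (\<lambda>u :: real ^ 'm. \<chi> l. \<epsilon> + R * u $ l)"
      by (intro continuous_intros)
    show "(\<lambda>u :: real ^ 'm. \<chi> l. \<epsilon> + R * u $ l) ` cbox 0 1 \<subseteq> open_cube \<rho>"
    proof (rule image_subsetI, unfold mem_open_cube_iff, intro allI)
      fix u :: "real ^ 'm" and l assume "u \<in> cbox 0 1"
      then have u: "0 \<le> u $ l" "u $ l \<le> 1" by (auto simp: mem_box_cart)
      have "\<epsilon> + R * u $ l \<le> \<epsilon> + R" using u R by (simp add: mult_left_le)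
      then have "ereal (\<epsilon> + R * u $ l) < \<rho>" using \<epsilon>R by (metis ereal_less_eq(3) le_less_trans)
      then show "0 < (\<chi> l. \<epsilon> + R * u $ l) $ l \<and> ereal ((\<chi> l. \<epsilon> + R * u $ l) $ l) < \<rho>"
        using u R \<epsilon> by (simp add: add_pos_nonneg)
    qed
  qed
  then obtain n where n: "0 < n" "\<And>x. x \<in> cbox 0 1 \<Longrightarrow>
    \<bar>f x - (\<Sum>j | \<forall>l. j l \<le> n. f (\<chi> l. real (j l) / real n) * (\<Prod>l\<in>UNIV. Bernstein n (j l) (x $ l)))\<bar> < \<eta>"
    using multivariate_Bernstein_approximation[OF _ \<eta>] by blast
  define c where "c = (\<lambda>k :: 'm \<Rightarrow> nat. (\<Prod>l\<in>UNIV. real (n choose k l)) * mixed_difference f k (1 / real n) 0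
      / R ^ (\<Sum>l\<in>UNIV. k l))"
  have "0 \<le> c k" if "\<forall>l. k l \<le> n" for k
  proof -
    have "mixed_difference f k (1 / real n) 0 = mixed_difference F k (R / real n) (\<chi> l. \<epsilon>)"
      by (simp add: mixed_difference_def f_def mult.commute)
    also have "\<dots> \<ge> 0"
    proof (rule diff)
      fix l
      have "R / real n * real (k l) \<le> R / real n * real n"
        using R that by (intro mult_left_mono) auto
      also have "\<dots> = R" using n(1) by simp
      finally have "\<epsilon> + R / real n * real (k l) \<le> \<epsilon> + R" by simp
      then show "ereal ((\<chi> l. \<epsilon>) $ l + R / real n * real (k l)) < \<rho>"
        using \<epsilon>R by (metis ereal_less_eq(3) le_less_trans vec_lambda_beta)
    qed (use R n(1) \<epsilon> in auto)
    finally show ?thesis using R by (simp add: c_def prod_nonneg)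
  qed
  moreover have "\<bar>F (\<chi> l. \<epsilon> + x $ l) - (\<Sum>k | \<forall>l. k l \<le> n. c k * monomial x k)\<bar> < \<eta>"
    if x: "\<forall>l. 0 \<le> x $ l \<and> x $ l \<le> R" for x :: "real ^ 'm"
  proof -
    define u where "u = ((\<chi> l. x $ l / R) :: real ^ 'm)"
    have u: "u \<in> cbox 0 1" using x R by (auto simp: u_def mem_box_cart)
    have fu: "f u = F (\<chi> l. \<epsilon> + x $ l)" using R by (simp add: f_def u_def)
    have "c k * monomial x k = (\<Prod>l\<in>UNIV. real (n choose k l)) * mixed_difference f k (1 / real n) 0 * monomial u k" for k
      by (simp add: c_def u_def monomial_def power_divide prod_dividef power_sum)
    then show ?thesis using n(2)[OF u] unfolding fu multivariate_Bernstein_eq_mixed_differences by simp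
  qed
  ultimately show ?thesis by blast
qed

section \<open>Limits of polynomials with nonnegative coefficients\<close>

definition power_series_on_cube ::
    "ereal \<Rightarrow> (('m \<Rightarrow> nat) \<Rightarrow> real) \<Rightarrow> (real ^ 'm::finite \<Rightarrow> real) \<Rightarrow> bool" where
  "power_series_on_cube \<rho> c F \<longleftrightarrow>
     (\<forall>\<alpha>. 0 \<le> c \<alpha>) \<and> (\<forall>x\<in>open_cube \<rho>. ((\<lambda>\<alpha>. c \<alpha> * monomial x \<alpha>) has_sum F x) UNIV)"

lemma monomial_pos:
  fixes x :: "real ^ 'm::finite"
  shows "x \<in> open_cube \<rho> \<Longrightarrow> 0 < monomial x \<alpha>"
  by (simp add: monomial_def mem_open_cube_iff prod_pos)

lemma monomial_scaleR:
  fixes x :: "real ^ 'm::finite"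
  shows "monomial (s *\<^sub>R x) \<alpha> = s ^ (\<Sum>l\<in>UNIV. \<alpha> l) * monomial x \<alpha>"
  by (simp add: monomial_def power_mult_distrib prod.distrib power_sum)

text \<open>
  No limit of the individual coefficients is given. Since the terms are nonnegative, each one is bounded by
  the value of the polynomial at a fixed point \<open>x0\<close>, so some subsequence converges coefficientwise. That no
  mass escapes to infinity is seen by comparing the values at \<open>x\<close> and at a dilated point \<open>s *\<^sub>R x\<close>: monomials in
  which some exponent exceeds \<open>K\<close> grow at least by the factor \<open>s ^ K\<close>.
\<close>

lemma limit_of_nonneg_polynomials:
  fixes F :: "real ^ 'm::finite \<Rightarrow> real" and b :: "nat \<Rightarrow> ('m \<Rightarrow> nat) \<Rightarrow> real"
  assumes nonneg: "\<And>n k. 0 \<le> b n k" and fin: "\<And>n. finite {k. b n k \<noteq> 0}"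
    and lim: "\<And>x. x \<in> open_cube \<rho> \<Longrightarrow> (\<lambda>n. \<Sum>k | b n k \<noteq> 0. b n k * monomial x k) \<longlonglongrightarrow> F x"
    and ne: "open_cube \<rho> \<noteq> ({} :: (real ^ 'm) set)"
  obtains a where "power_series_on_cube \<rho> a F"
proof -
  define P where "P = (\<lambda>n x. \<Sum>k | b n k \<noteq> 0. b n k * monomial x k)"
  have partial: "(\<Sum>k\<in>T. b n k * monomial x k) \<le> P n x" if "finite T" "x \<in> open_cube \<rho>" for T n x
  proof -
    have "(\<Sum>k\<in>T. b n k * monomial x k) = (\<Sum>k\<in>T \<inter> {k. b n k \<noteq> 0}. b n k * monomial x k)"
      using that by (intro sum.mono_neutral_right) auto
    also have "\<dots> \<le> P n x"
      unfolding P_def using fin nonneg monomial_pos[OF that(2)]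
      by (intro sum_mono2) (auto intro!: mult_nonneg_nonneg simp: less_imp_le)
    finally show ?thesis .
  qed
  obtain x0 :: "real ^ 'm" where x0: "x0 \<in> open_cube \<rho>" using ne by blast
  have "Bseq (\<lambda>n. P n x0)" using lim[OF x0] unfolding P_def by (rule convergentI[THEN convergent_imp_Bseq])
  then obtain B where B: "\<And>n. \<bar>P n x0\<bar> \<le> B" by (auto simp: Bseq_def)
  have bounded: "norm (b n k * monomial x0 k) \<le> B" for n k
    using partial[of "{k}" x0 n] x0 B[of n] nonneg[of n k] monomial_pos[OF x0, of k] by auto
  obtain r where r: "strict_mono (r :: nat \<Rightarrow> nat)"
      "\<And>k. k \<in> UNIV \<Longrightarrow> \<exists>L. (\<lambda>n. b (r n) k * monomial x0 k) \<longlonglongrightarrow> L"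
    by (rule function_convergent_subsequence[of UNIV "\<lambda>n k. b n k * monomial x0 k" B])
      (use bounded in auto)
  have "\<exists>a. (\<lambda>n. b (r n) k) \<longlonglongrightarrow> a" for k
  proof -
    obtain L where "(\<lambda>n. b (r n) k * monomial x0 k) \<longlonglongrightarrow> L" using r(2)[of k] by auto
    then have "(\<lambda>n. b (r n) k * monomial x0 k / monomial x0 k) \<longlonglongrightarrow> L / monomial x0 k"
      using monomial_pos[OF x0, of k] by (intro tendsto_intros) auto
    then show ?thesis using monomial_pos[OF x0, of k] by auto
  qed
  then obtain a where a: "\<And>k. (\<lambda>n. b (r n) k) \<longlonglongrightarrow> a k" by metis
  have a_nonneg: "0 \<le> a k" for k
    using a[of k] nonneg by (intro LIMSEQ_le_const) auto
  have limr: "(\<lambda>n. P (r n) x) \<longlonglongrightarrow> F x" if "x \<in> open_cube \<rho>" for x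
    using LIMSEQ_subseq_LIMSEQ[OF lim[OF that] r(1)] by (simp add: P_def o_def)
  have "((\<lambda>\<alpha>. a \<alpha> * monomial x \<alpha>) has_sum F x) UNIV" if x: "x \<in> open_cube \<rho>" for x
  proof -
    have lim_partial: "(\<lambda>n. \<Sum>k\<in>T. b (r n) k * monomial x k) \<longlonglongrightarrow> (\<Sum>k\<in>T. a k * monomial x k)" for T
      by (intro tendsto_intros a)
    have upper: "(\<Sum>k\<in>T. a k * monomial x k) \<le> F x" if "finite T" for T
      using partial[OF that x] by (intro LIMSEQ_le[OF lim_partial limr[OF x]]) auto
    have term_nonneg: "0 \<le> a k * monomial x k" for k
      using a_nonneg monomial_pos[OF x] by (simp add: less_imp_le)
    have summable: "(\<lambda>k. a k * monomial x k) summable_on UNIV"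
      using upper term_nonneg by (intro nonneg_bdd_above_summable_on) (auto intro!: bdd_aboveI)
    have "(\<Sum>\<^sub>\<infinity>k. a k * monomial x k) \<le> F x"
      using summable upper by (intro infsum_le_finite_sums) auto
    moreover have "F x \<le> (\<Sum>\<^sub>\<infinity>k. a k * monomial x k)"
    proof -
      obtain s where s: "1 < s" "s *\<^sub>R x \<in> open_cube \<rho>" by (rule open_cube_dilation[OF x])
      have bound: "F x \<le> (\<Sum>\<^sub>\<infinity>k. a k * monomial x k) + F (s *\<^sub>R x) / s ^ K" for K
      proof -
        let ?T = "{k :: 'm \<Rightarrow> nat. \<forall>l. k l \<le> K}"
        have T: "finite ?T" by (rule finite_Collect_le_fun)
        have le: "P n x \<le> (\<Sum>k\<in>?T. b n k * monomial x k) + P n (s *\<^sub>R x) / s ^ K" for n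
        proof -
          have "P n x = (\<Sum>k\<in>{k. b n k \<noteq> 0} \<inter> ?T. b n k * monomial x k)
              + (\<Sum>k\<in>{k. b n k \<noteq> 0} - ?T. b n k * monomial x k)"
            unfolding P_def using fin by (intro sum.Int_Diff)
          moreover have "(\<Sum>k\<in>{k. b n k \<noteq> 0} \<inter> ?T. b n k * monomial x k) \<le> (\<Sum>k\<in>?T. b n k * monomial x k)"
            using T nonneg monomial_pos[OF x] by (intro sum_mono2) (auto simp: less_imp_le)
          moreover have "(\<Sum>k\<in>{k. b n k \<noteq> 0} - ?T. b n k * monomial x k) \<le> P n (s *\<^sub>R x) / s ^ K"
          proof -
            have "monomial x k \<le> monomial (s *\<^sub>R x) k / s ^ K" if k: "k \<notin> ?T" for k
            proof -
              obtain l where "K \<le> k l" using k by (auto simp: not_le intro: less_imp_le)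
              also have "k l \<le> (\<Sum>l\<in>UNIV. k l)" by (rule member_le_sum) auto
              finally have "s ^ K \<le> s ^ (\<Sum>l\<in>UNIV. k l)" using s(1) by (intro power_increasing) auto
              then have "s ^ K * monomial x k \<le> s ^ (\<Sum>l\<in>UNIV. k l) * monomial x k"
                using monomial_pos[OF x] by (intro mult_right_mono) (auto simp: less_imp_le)
              then show ?thesis using s(1) by (simp add: monomial_scaleR field_simps)
            qed
            then have "(\<Sum>k\<in>{k. b n k \<noteq> 0} - ?T. b n k * monomial x k)
                \<le> (\<Sum>k\<in>{k. b n k \<noteq> 0} - ?T. b n k * (monomial (s *\<^sub>R x) k / s ^ K))"
              using nonneg by (intro sum_mono mult_left_mono) auto
            also have "\<dots> \<le> (\<Sum>k | b n k \<noteq> 0. b n k * (monomial (s *\<^sub>R x) k / s ^ K))"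
              using fin nonneg monomial_pos[OF s(2)] s(1)
              by (intro sum_mono2) (auto simp: less_imp_le)
            also have "\<dots> = P n (s *\<^sub>R x) / s ^ K" by (simp add: P_def sum_divide_distrib)
            finally show ?thesis .
          qed
          ultimately show ?thesis by linarith
        qed
        have "F x \<le> (\<Sum>k\<in>?T. a k * monomial x k) + F (s *\<^sub>R x) / s ^ K"
        proof (rule LIMSEQ_le[OF limr[OF x]])
          show "(\<lambda>n. (\<Sum>k\<in>?T. b (r n) k * monomial x k) + P (r n) (s *\<^sub>R x) / s ^ K)
              \<longlonglongrightarrow> (\<Sum>k\<in>?T. a k * monomial x k) + F (s *\<^sub>R x) / s ^ K"
            using s(1) by (intro tendsto_intros lim_partial limr[OF s(2)]) auto
        qed (use le in auto)
        also have "(\<Sum>k\<in>?T. a k * monomial x k) \<le> (\<Sum>\<^sub>\<infinity>k. a k * monomial x k)"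
          using summable T term_nonneg by (intro finite_sum_le_infsum) auto
        finally show ?thesis by simp
      qed
      have "(\<lambda>K. (\<Sum>\<^sub>\<infinity>k. a k * monomial x k) + F (s *\<^sub>R x) * (1 / s) ^ K)
          \<longlonglongrightarrow> (\<Sum>\<^sub>\<infinity>k. a k * monomial x k) + F (s *\<^sub>R x) * 0"
        using s(1) by (intro tendsto_intros LIMSEQ_realpow_zero) auto
      moreover have "F x \<le> (\<Sum>\<^sub>\<infinity>k. a k * monomial x k) + F (s *\<^sub>R x) * (1 / s) ^ K" for K
        using bound[of K] by (simp add: power_divide)
      ultimately show ?thesis by (intro LIMSEQ_le_const) auto
    qed
    ultimately show ?thesis using summable by (simp add: has_sum_iff)
  qed
  then show ?thesis using that a_nonneg by (auto simp: power_series_on_cube_def)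
qed

lemma exhausting_radii:
  assumes \<rho>: "0 < (\<rho> :: ereal)"
  obtains R \<epsilon> :: "nat \<Rightarrow> real" where "\<forall>n. 0 < R n \<and> 0 < \<epsilon> n \<and> ereal (\<epsilon> n + R n) < \<rho>"
    "\<epsilon> \<longlonglongrightarrow> 0" "\<forall>x. ereal x < \<rho> \<longrightarrow> (\<forall>\<^sub>F n in sequentially. x < R n)"
proof -
  obtain u :: "nat \<Rightarrow> ereal" where u: "\<And>n. u n < \<rho>" "u \<longlonglongrightarrow> \<rho>"
    using approx_from_below_dense_linorder[OF \<rho>] by blast
  have "\<exists>R>0. ereal R < \<rho> \<and> u n < ereal R" for n
  proof -
    have "max 0 (u n) < \<rho>" using u(1) \<rho> by simp
    then obtain R where "max 0 (u n) < ereal R" "ereal R < \<rho>" using ereal_dense2 by blast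
    then show ?thesis by (intro exI[of _ R]) auto
  qed
  then obtain R where R: "\<And>n. 0 < R n" "\<And>n. ereal (R n) < \<rho>" "\<And>n. u n < ereal (R n)" by metis
  have "\<exists>e>0. e \<le> 1 / real (Suc n) \<and> ereal (e + R n) < \<rho>" for n
  proof -
    obtain z where z: "ereal (R n) < ereal z" "ereal z < \<rho>" using R(2) ereal_dense2 by blast
    define e where "e = min (z - R n) (1 / real (Suc n))"
    have "e + R n \<le> z" by (simp add: e_def)
    then have "ereal (e + R n) < \<rho>" using z(2) by (metis ereal_less_eq(3) le_less_trans)
    then show ?thesis using z(1) by (intro exI[of _ e]) (auto simp: e_def)
  qed
  then obtain \<epsilon> where \<epsilon>: "\<And>n. 0 < \<epsilon> n" "\<And>n. \<epsilon> n \<le> 1 / real (Suc n)" "\<And>n. ereal (\<epsilon> n + R n) < \<rho>" by metis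
  have \<epsilon>_lim: "\<epsilon> \<longlonglongrightarrow> 0"
    using \<epsilon> by (intro tendsto_sandwich[OF _ _ tendsto_const LIMSEQ_Suc[OF lim_1_over_n]])
      (auto simp: less_imp_le)
  have "\<forall>\<^sub>F n in sequentially. x < R n" if "ereal x < \<rho>" for x
    using order_tendstoD(1)[OF u(2) that]
  proof eventually_elim
    case (elim n)
    then have "ereal x < ereal (R n)" using R(3) less_trans by blast
    then show ?case by simp
  qed
  then show ?thesis using R(1) \<epsilon>(1,3) \<epsilon>_lim by (intro that[of R \<epsilon>]) auto
qed

text \<open>
  The several-variable form of Bernstein's theorem on absolutely monotonic functions, with differences in place of derivatives.
\<close>

lemma power_series_if_mixed_differences_nonneg:
  fixes F :: "real ^ 'm::finite \<Rightarrow> real"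
  assumes \<rho>: "0 < \<rho>"
    and cont: "continuous_on (open_cube \<rho>) F"
    and diff: "\<And>\<alpha> h a. 0 < h \<Longrightarrow> (\<And>l. 0 < a $ l) \<Longrightarrow> (\<And>l. ereal (a $ l + h * real (\<alpha> l)) < \<rho>) \<Longrightarrow>
      0 \<le> mixed_difference F \<alpha> h a"
  obtains a where "power_series_on_cube \<rho> a F"
proof -
  obtain R \<epsilon> :: "nat \<Rightarrow> real" where radii: "\<forall>n. 0 < R n \<and> 0 < \<epsilon> n \<and> ereal (\<epsilon> n + R n) < \<rho>"
    and \<epsilon>_lim: "\<epsilon> \<longlonglongrightarrow> 0"
    and exhaust: "\<forall>x. ereal x < \<rho> \<longrightarrow> (\<forall>\<^sub>F n in sequentially. x < R n)"
    by (rule exhausting_radii[OF \<rho>])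
  have R: "0 < R n" and \<epsilon>: "0 < \<epsilon> n" and \<epsilon>R: "ereal (\<epsilon> n + R n) < \<rho>" for n
    using radii by auto
  define approx where "approx = (\<lambda>n N c. (\<forall>k. (\<forall>l. k l \<le> N) \<longrightarrow> 0 \<le> c k) \<and>
    (\<forall>x. (\<forall>l. 0 \<le> x $ l \<and> x $ l \<le> R n) \<longrightarrow>
      \<bar>F (\<chi> l. \<epsilon> n + x $ l) - (\<Sum>k | \<forall>l. k l \<le> N. c k * monomial x k)\<bar> < 1 / real (Suc n)))"
  have "\<exists>N c. approx n N c" for n
    unfolding approx_def by (rule nonneg_polynomial_approximation[OF cont diff R \<epsilon> \<epsilon>R]) auto
  then obtain N c where "\<And>n. approx n (N n) (c n)" by metis
  then have c: "\<And>n k. (\<forall>l. k l \<le> N n) \<Longrightarrow> 0 \<le> c n k"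
    "\<And>n x. (\<forall>l. 0 \<le> x $ l \<and> x $ l \<le> R n) \<Longrightarrow>
      \<bar>F (\<chi> l. \<epsilon> n + x $ l) - (\<Sum>k | \<forall>l. k l \<le> N n. c n k * monomial x k)\<bar> < 1 / real (Suc n)"
    unfolding approx_def by blast+
  define b where "b = (\<lambda>n k. if \<forall>l. k l \<le> N n then c n k else 0)"
  have b_sum: "(\<Sum>k | b n k \<noteq> 0. b n k * monomial x k) = (\<Sum>k | \<forall>l. k l \<le> N n. c n k * monomial x k)" for n x
  proof -
    have "(\<Sum>k | b n k \<noteq> 0. b n k * monomial x k) = (\<Sum>k | \<forall>l. k l \<le> N n. b n k * monomial x k)"
      by (intro sum.mono_neutral_left finite_Collect_le_fun[of "\<lambda>_. N n"]) (auto simp: b_def)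
    then show ?thesis by (simp add: b_def)
  qed
  show ?thesis
  proof (rule limit_of_nonneg_polynomials[of b \<rho> F])
    show "0 \<le> b n k" for n k using c(1) by (simp add: b_def)
    show "finite {k. b n k \<noteq> 0}" for n
      by (rule finite_subset[OF _ finite_Collect_le_fun[of "\<lambda>_. N n"]]) (auto simp: b_def)
    obtain z where "0 < ereal z" "ereal z < \<rho>" using \<rho> ereal_dense2 by blast
    then have "(\<chi> l. z) \<in> (open_cube \<rho> :: (real ^ 'm) set)" by (simp add: mem_open_cube_iff)
    then show "open_cube \<rho> \<noteq> ({} :: (real ^ 'm) set)" by blast
    fix x :: "real ^ 'm" assume x: "x \<in> open_cube \<rho>"
    have "isCont F x" using cont x by (simp add: continuous_on_eq_continuous_at[OF open_open_cube])
    moreover have "(\<lambda>n. \<chi> l. \<epsilon> n + x $ l) \<longlonglongrightarrow> (\<chi> l. 0 + x $ l)"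
      by (intro tendsto_intros \<epsilon>_lim)
    ultimately have lim: "(\<lambda>n. F (\<chi> l. \<epsilon> n + x $ l)) \<longlonglongrightarrow> F x"
      by (intro isCont_tendsto_compose[of _ F]) auto
    have "\<forall>\<^sub>F n in sequentially. \<forall>l. x $ l < R n"
      using exhaust x by (intro eventually_all_finite) (auto simp: mem_open_cube_iff)
    then have "\<forall>\<^sub>F n in sequentially. norm (F (\<chi> l. \<epsilon> n + x $ l) -
        (\<Sum>k | \<forall>l. k l \<le> N n. c n k * monomial x k)) \<le> 1 / real (Suc n)"
    proof eventually_elim
      case (elim n)
      then show ?case using c(2)[of x n] x by (auto simp: mem_open_cube_iff less_imp_le)
    qed
    then have "(\<lambda>n. F (\<chi> l. \<epsilon> n + x $ l) - (\<Sum>k | \<forall>l. k l \<le> N n. c n k * monomial x k)) \<longlonglongrightarrow> 0"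
      by (rule Lim_null_comparison) (rule LIMSEQ_Suc[OF lim_1_over_n])
    from tendsto_diff[OF lim this]
    show "(\<lambda>n. \<Sum>k | b n k \<noteq> 0. b n k * monomial x k) \<longlonglongrightarrow> F x" by (simp add: b_sum)
  qed (rule that)
qed

section \<open>Power series with nonnegative coefficients\<close>

lemma monomial_update_coord:
  fixes x :: "real ^ 'm::finite"
  shows "monomial (update_coord x l t) \<alpha> = (\<Prod>j\<in>UNIV - {l}. (x $ j) ^ \<alpha> j) * t ^ \<alpha> l"
proof -
  have "monomial (update_coord x l t) \<alpha> = t ^ \<alpha> l * (\<Prod>j\<in>UNIV - {l}. (update_coord x l t $ j) ^ \<alpha> j)"
    unfolding monomial_def by (subst prod.remove[of _ l]) (auto simp: update_coord_def)
  also have "(\<Prod>j\<in>UNIV - {l}. (update_coord x l t $ j) ^ \<alpha> j) = (\<Prod>j\<in>UNIV - {l}. (x $ j) ^ \<alpha> j)"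
    by (intro prod.cong) (auto simp: update_coord_def)
  finally show ?thesis by (simp add: mult.commute)
qed

lemma update_coord_in_open_cube:
  "x \<in> open_cube \<rho> \<Longrightarrow> 0 < t \<Longrightarrow> ereal t < \<rho> \<Longrightarrow> update_coord x l t \<in> open_cube \<rho>"
  by (auto simp: mem_open_cube_iff update_coord_def)

lemma update_coord_same [simp]: "update_coord x l (x $ l) = x"
  by (simp add: update_coord_def Finite_Cartesian_Product.vec_eq_iff)

text \<open>
  The coefficients of the partial derivative of a power series in the direction \<open>l\<close>.
\<close>

definition shifted_coeffs :: "'m \<Rightarrow> (('m \<Rightarrow> nat) \<Rightarrow> real) \<Rightarrow> ('m \<Rightarrow> nat) \<Rightarrow> real" where
  "shifted_coeffs l c \<beta> = real (Suc (\<beta> l)) * c (\<beta>(l := Suc (\<beta> l)))"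

text \<open>
  As a function of the coordinate \<open>l\<close> alone, \<open>F\<close> extends to a sum of complex powers that converges
  uniformly near \<open>x $ l\<close>. Locally uniform limits of holomorphic functions may be differentiated
  termwise, and this holds for the limit along finite sets of indices, so the sum over
  multi-indices need not be rearranged.
\<close>

lemma power_series_partial_derivative:
  fixes F :: "real ^ 'm::finite \<Rightarrow> real"
  assumes F: "power_series_on_cube \<rho> c F" and x: "x \<in> open_cube \<rho>"
  obtains d where "((\<lambda>t. F (update_coord x l t)) has_real_derivative d) (at (x $ l))"
    "((\<lambda>\<alpha>. shifted_coeffs l c \<alpha> * monomial x \<alpha>) has_sum d) UNIV"
proof -
  have c0: "0 \<le> c \<alpha>" for \<alpha> using F by (simp add: power_series_on_cube_def)
  have xl: "0 < x $ l" "ereal (x $ l) < \<rho>" using x by (auto simp: mem_open_cube_iff)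
  obtain r0 where r0: "0 < r0" "ereal (x $ l + r0) < \<rho>"
    using ereal_less_uniform_room[of "\<lambda>_ :: 'm. x $ l" \<rho>] xl(2) by metis
  define r where "r = min r0 (x $ l / 2)"
  have r: "0 < r" "r \<le> r0" "r < x $ l" using r0(1) xl(1) by (auto simp: r_def)
  have xr: "ereal (x $ l + r) < \<rho>"
    using r(2) r0(2) by (metis add_left_mono ereal_less_eq(3) le_less_trans)
  have in_cube: "update_coord x l t \<in> open_cube \<rho>" if "\<bar>t - x $ l\<bar> \<le> r" for t
  proof -
    have "0 < t" "t \<le> x $ l + r" using that r(3) by linarith+
    then show ?thesis using x xr by (meson ereal_less_eq(3) le_less_trans update_coord_in_open_cube)
  qed
  define C where "C = (\<lambda>\<alpha> :: 'm \<Rightarrow> nat. c \<alpha> * (\<Prod>j\<in>UNIV - {l}. (x $ j) ^ \<alpha> j))"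
  have C0: "0 \<le> C \<alpha>" for \<alpha>
    unfolding C_def using c0 x by (intro mult_nonneg_nonneg prod_nonneg) (auto simp: mem_open_cube_iff less_imp_le)
  have C_sum: "((\<lambda>\<alpha>. C \<alpha> * t ^ \<alpha> l) has_sum F (update_coord x l t)) UNIV" if "\<bar>t - x $ l\<bar> \<le> r" for t
  proof -
    have "((\<lambda>\<alpha>. c \<alpha> * monomial (update_coord x l t) \<alpha>) has_sum F (update_coord x l t)) UNIV"
      using F in_cube[OF that] by (auto simp: power_series_on_cube_def)
    then show ?thesis by (simp add: monomial_update_coord C_def mult.assoc)
  qed
  define z where "z = complex_of_real (x $ l)"
  define f where "f = (\<lambda>S w. \<Sum>\<alpha>\<in>S. complex_of_real (C \<alpha>) * w ^ \<alpha> l)"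
  define f' where "f' = (\<lambda>S w. \<Sum>\<alpha>\<in>S. complex_of_real (C \<alpha>) * (of_nat (\<alpha> l) * w ^ (\<alpha> l - 1)))"
  define g where "g = (\<lambda>w. \<Sum>\<^sub>\<infinity>\<alpha>. complex_of_real (C \<alpha>) * w ^ \<alpha> l)"
  have unif: "uniform_limit (cball z r) f g (finite_subsets_at_top UNIV)"
    unfolding f_def g_def
  proof (rule Weierstrass_m_test_general)
    show "(\<lambda>\<alpha>. C \<alpha> * (x $ l + r) ^ \<alpha> l) summable_on UNIV"
      using C_sum[of "x $ l + r"] r(1) by (auto simp: has_sum_iff)
    fix \<alpha> w assume "w \<in> cball z r"
    then have "norm w \<le> x $ l + r"
      using norm_triangle_sub[of w z] xl(1) by (auto simp: dist_norm norm_minus_commute z_def)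
    then show "norm (complex_of_real (C \<alpha>) * w ^ \<alpha> l) \<le> C \<alpha> * (x $ l + r) ^ \<alpha> l"
      using C0 by (simp add: norm_mult norm_power mult_left_mono power_mono)
  qed
  have ev: "\<forall>\<^sub>F S in finite_subsets_at_top UNIV. continuous_on (cball z r) (f S) \<and>
      (\<forall>w\<in>ball z r. (f S has_field_derivative f' S w) (at w))"
    unfolding f_def f'_def
    by (intro always_eventually allI conjI ballI continuous_intros)
      (auto intro!: derivative_eq_intros sum.cong simp: mult_ac)
  obtain g' where g': "\<And>w. w \<in> ball z r \<Longrightarrow> (g has_field_derivative g' w) (at w) \<and>
      ((\<lambda>S. f' S w) \<longlongrightarrow> g' w) (finite_subsets_at_top UNIV)"
    using has_complex_derivative_uniform_limit[OF ev unif _ r(1)] by auto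
  have zb: "z \<in> ball z r" using r(1) by simp
  define d where "d = Re (g' z)"
  have g_real: "g (complex_of_real t) = complex_of_real (F (update_coord x l t))" if "\<bar>t - x $ l\<bar> \<le> r" for t
    using has_sum_of_real[OF C_sum[OF that], where 'a = complex] by (simp add: g_def infsumI)
  have "((\<lambda>t. F (update_coord x l t)) has_real_derivative d) (at (x $ l))"
  proof -
    have "((\<lambda>t. g (complex_of_real t)) has_vector_derivative g' z) (at (x $ l))"
      using g'[OF zb] unfolding z_def by (intro has_vector_derivative_real_field) auto
    from bounded_linear.has_vector_derivative[OF bounded_linear_Re this]
    have "((\<lambda>t. Re (g (complex_of_real t))) has_real_derivative d) (at (x $ l))"
      by (simp add: has_real_derivative_iff_has_vector_derivative d_def)
    then show ?thesis
    proof (rule has_field_derivative_transform_within_open)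
      show "open (ball (x $ l) r)" "x $ l \<in> ball (x $ l) r" using r(1) by auto
      fix t assume "t \<in> ball (x $ l) r"
      then show "Re (g (complex_of_real t)) = F (update_coord x l t)"
        by (subst g_real) (auto simp: dist_real_def abs_minus_commute)
    qed
  qed
  moreover have "((\<lambda>\<alpha>. shifted_coeffs l c \<alpha> * monomial x \<alpha>) has_sum d) UNIV"
  proof -
    have "((\<lambda>\<alpha>. complex_of_real (C \<alpha>) * (of_nat (\<alpha> l) * z ^ (\<alpha> l - 1))) has_sum g' z) UNIV"
      using g'[OF zb] by (simp add: has_sum_def f'_def)
    moreover have "complex_of_real (C \<alpha>) * (of_nat (\<alpha> l) * z ^ (\<alpha> l - 1))
        = complex_of_real (C \<alpha> * (real (\<alpha> l) * (x $ l) ^ (\<alpha> l - 1)))" for \<alpha>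
      by (simp add: z_def)
    ultimately have "((\<lambda>\<alpha>. complex_of_real (C \<alpha> * (real (\<alpha> l) * (x $ l) ^ (\<alpha> l - 1)))) has_sum g' z) UNIV"
      by (simp only:)
    from has_sum_Re[OF this]
    have "((\<lambda>\<alpha>. C \<alpha> * (real (\<alpha> l) * (x $ l) ^ (\<alpha> l - 1))) has_sum d) UNIV"
      by (simp only: Re_complex_of_real d_def)
    \<comment> \<open>the terms with \<open>\<alpha> l = 0\<close> vanish, the others are indexed by \<open>\<beta>\<close> with \<open>\<alpha> = \<beta> + e\<^sub>l\<close>\<close>
    moreover define h where "h = (\<lambda>\<beta> :: 'm \<Rightarrow> nat. \<beta>(l := Suc (\<beta> l)))"
    have "range h = {\<alpha>. \<alpha> l \<noteq> 0}"
    proof (intro equalityI subsetI)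
      fix \<alpha> :: "'m \<Rightarrow> nat" assume "\<alpha> \<in> {\<alpha>. \<alpha> l \<noteq> 0}"
      then have "\<alpha> = h (\<alpha>(l := \<alpha> l - 1))" by (auto simp: h_def)
      then show "\<alpha> \<in> range h" by blast
    qed (auto simp: h_def)
    then have "((\<lambda>\<alpha>. C \<alpha> * (real (\<alpha> l) * (x $ l) ^ (\<alpha> l - 1))) has_sum d) UNIV \<longleftrightarrow>
        ((\<lambda>\<alpha>. C \<alpha> * (real (\<alpha> l) * (x $ l) ^ (\<alpha> l - 1))) has_sum d) (range h)"
      by (intro has_sum_cong_neutral) auto
    moreover have "inj h"
    proof (rule injI)
      fix \<beta> \<gamma> assume "h \<beta> = h \<gamma>"
      then have "h \<beta> j = h \<gamma> j" for j by simp
      then have "\<beta> j = \<gamma> j" for j by (auto simp: h_def split: if_splits) (metis fun_upd_def nat.inject)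
      then show "\<beta> = \<gamma>" by auto
    qed
    ultimately have "((\<lambda>\<alpha>. C \<alpha> * (real (\<alpha> l) * (x $ l) ^ (\<alpha> l - 1))) \<circ> h has_sum d) UNIV"
      by (simp add: has_sum_reindex)
    moreover have "((\<lambda>\<alpha>. C \<alpha> * (real (\<alpha> l) * (x $ l) ^ (\<alpha> l - 1))) \<circ> h) \<beta>
        = shifted_coeffs l c \<beta> * monomial x \<beta>" for \<beta>
    proof -
      have "monomial x \<beta> = (\<Prod>j\<in>UNIV - {l}. (x $ j) ^ \<beta> j) * (x $ l) ^ \<beta> l"
        using monomial_update_coord[of x l "x $ l" \<beta>] by simp
      moreover have "(\<Prod>j\<in>UNIV - {l}. (x $ j) ^ h \<beta> j) = (\<Prod>j\<in>UNIV - {l}. (x $ j) ^ \<beta> j)"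
        by (intro prod.cong) (auto simp: h_def)
      ultimately show ?thesis by (simp add: C_def shifted_coeffs_def h_def mult_ac)
    qed
    ultimately show ?thesis by (simp add: o_def)
  qed
  ultimately show ?thesis using that by blast
qed

lemma power_series_partial_deriv:
  fixes F :: "real ^ 'm::finite \<Rightarrow> real"
  assumes F: "power_series_on_cube \<rho> c F"
  shows "power_series_on_cube \<rho> (shifted_coeffs l c) (partial_deriv l F)"
  unfolding power_series_on_cube_def
proof (intro conjI allI ballI)
  show "0 \<le> shifted_coeffs l c \<alpha>" for \<alpha>
    using F by (simp add: power_series_on_cube_def shifted_coeffs_def)
  fix x :: "real ^ 'm" assume x: "x \<in> open_cube \<rho>"
  obtain d where d: "((\<lambda>t. F (update_coord x l t)) has_real_derivative d) (at (x $ l))"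
    "((\<lambda>\<alpha>. shifted_coeffs l c \<alpha> * monomial x \<alpha>) has_sum d) UNIV"
    by (rule power_series_partial_derivative[OF F x])
  then show "((\<lambda>\<alpha>. shifted_coeffs l c \<alpha> * monomial x \<alpha>) has_sum partial_deriv l F x) UNIV"
    by (simp add: partial_deriv_def DERIV_imp_deriv)
qed

lemma power_series_iter_partial:
  fixes F :: "real ^ 'm::finite \<Rightarrow> real"
  assumes F: "power_series_on_cube \<rho> c F"
  shows "\<exists>c'. power_series_on_cube \<rho> c' (iter_partial ls F)"
proof (induction ls)
  case Nil
  show ?case using F by (auto simp: iter_partial_def)
next
  case (Cons l ls)
  then obtain c' where "power_series_on_cube \<rho> c' (iter_partial ls F)" by blast
  from power_series_partial_deriv[OF this, of l] show ?case by (auto simp: iter_partial_def)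
qed

text \<open>
  All iterated partial derivatives are sums of power series with nonnegative coefficients.
\<close>

lemma power_series_imp_absolutely_monotonic:
  fixes F :: "real ^ 'm::finite \<Rightarrow> real"
  assumes F: "power_series_on_cube \<rho> c F" and cont: "continuous_on (open_cube \<rho>) F"
  shows "absolutely_monotonic_on (open_cube \<rho>) F"
  unfolding absolutely_monotonic_on_def
proof (intro conjI allI ballI cont)
  fix ls :: "'m list" and x :: "real ^ 'm" assume x: "x \<in> open_cube \<rho>"
  obtain c' where c': "power_series_on_cube \<rho> c' (iter_partial ls F)"
    using power_series_iter_partial[OF F] by blast
  show "(\<lambda>t. iter_partial ls F (update_coord x l t)) differentiable at (x $ l)" for l
    by (rule power_series_partial_derivative[OF c' x, of l]) (auto simp: real_differentiable_def)
  show "0 \<le> iter_partial ls F x"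
  proof (rule has_sum_nonneg)
    show "((\<lambda>\<alpha>. c' \<alpha> * monomial x \<alpha>) has_sum iter_partial ls F x) UNIV"
      using c' x by (auto simp: power_series_on_cube_def)
    show "0 \<le> c' \<alpha> * monomial x \<alpha>" for \<alpha>
      using c' monomial_pos[OF x, of \<alpha>] by (simp add: power_series_on_cube_def)
  qed
qed

lemma binomial_expansion_vector:
  fixes p w :: "('a::comm_semiring_1) ^ 'm::finite"
  shows "(\<Prod>l\<in>UNIV. (w $ l + p $ l) ^ \<alpha> l) =
    (\<Sum>\<beta> | \<forall>l. \<beta> l \<le> \<alpha> l. (\<Prod>l\<in>UNIV. of_nat (\<alpha> l choose \<beta> l) * (p $ l) ^ (\<alpha> l - \<beta> l)) * monomial w \<beta>)"
  unfolding binomial_ring prod_sum_le_fun monomial_def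
  by (intro sum.cong refl) (simp add: prod.distrib mult_ac)

text \<open>
  Expand each monomial at \<open>z = p + w\<close> by the binomial theorem and interchange the sums. The double series
  converges absolutely because, with absolute values inside, its rows sum to
  \<open>c \<alpha> * (|p| + |w|) ^ \<alpha>\<close>, and \<open>|p| + |w|\<close> stays below a point \<open>X\<close> of the cube.
\<close>

lemma power_series_imp_multi_analytic:
  fixes F :: "real ^ 'm::finite \<Rightarrow> real"
  assumes F: "power_series_on_cube \<rho> c F"
  shows "multi_analytic_on (\<lambda>z. \<Sum>\<^sub>\<infinity>\<alpha>. complex_of_real (c \<alpha>) * monomial z \<alpha>) (polydisc \<rho>)"
  unfolding multi_analytic_on_def
proof
  fix p :: "complex ^ 'm" assume p: "p \<in> polydisc \<rho>"
  have c0: "0 \<le> c \<alpha>" for \<alpha> using F by (simp add: power_series_on_cube_def)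
  have "ereal (norm (p $ l)) < \<rho>" for l using p by (simp add: polydisc_def)
  then obtain r where r: "0 < r" "\<And>l. ereal (norm (p $ l) + r) < \<rho>"
    using ereal_less_uniform_room[of "\<lambda>l. norm (p $ l)" \<rho>] by metis
  define X where "X = ((\<chi> l. norm (p $ l) + r) :: real ^ 'm)"
  have "X \<in> open_cube \<rho>" using r by (simp add: X_def mem_open_cube_iff add_nonneg_pos)
  then have X_summable: "(\<lambda>\<alpha>. c \<alpha> * monomial X \<alpha>) summable_on UNIV"
    using F by (auto simp: power_series_on_cube_def has_sum_iff)
  define B where "B = (\<lambda>\<alpha> \<beta> :: 'm \<Rightarrow> nat.
    complex_of_real (c \<alpha>) * (\<Prod>l\<in>UNIV. of_nat (\<alpha> l choose \<beta> l) * (p $ l) ^ (\<alpha> l - \<beta> l)))"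
  define a where "a = (\<lambda>\<beta>. \<Sum>\<^sub>\<infinity>\<alpha>. B \<alpha> \<beta>)"
  have "((\<lambda>\<beta>. a \<beta> * monomial (z - p) \<beta>) has_sum (\<Sum>\<^sub>\<infinity>\<alpha>. complex_of_real (c \<alpha>) * monomial z \<alpha>)) UNIV"
    if z: "\<forall>l. dist (z $ l) (p $ l) < r" for z
  proof -
    define w where "w = z - p"
    define T where "T = (\<lambda>(\<alpha>, \<beta>). B \<alpha> \<beta> * monomial w \<beta>)"
    have T0: "T (\<alpha>, \<beta>) = 0" if "\<not> (\<forall>l. \<beta> l \<le> \<alpha> l)" for \<alpha> \<beta>
      using that by (auto simp: T_def B_def not_le intro!: prod_zero)
    have T_row: "((\<lambda>\<beta>. T (\<alpha>, \<beta>)) has_sum complex_of_real (c \<alpha>) * monomial z \<alpha>) UNIV" for \<alpha>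
    proof (rule has_sum_finite_neutralI[OF finite_Collect_le_fun[of \<alpha>]])
      have "monomial z \<alpha> = (\<Prod>l\<in>UNIV. (w $ l + p $ l) ^ \<alpha> l)" by (simp add: monomial_def w_def)
      then show "complex_of_real (c \<alpha>) * monomial z \<alpha> = (\<Sum>\<beta> | \<forall>l. \<beta> l \<le> \<alpha> l. T (\<alpha>, \<beta>))"
        unfolding binomial_expansion_vector by (simp add: T_def B_def sum_distrib_left mult.assoc)
    qed (use T0 in auto)
    define P W where "P = ((\<chi> l. norm (p $ l)) :: real ^ 'm)" and "W = ((\<chi> l. norm (w $ l)) :: real ^ 'm)"
    define N where "N = (\<lambda>\<alpha>. c \<alpha> * (\<Prod>l\<in>UNIV. (W $ l + P $ l) ^ \<alpha> l))"
    have norm_row: "((\<lambda>\<beta>. norm (T (\<alpha>, \<beta>))) has_sum N \<alpha>) UNIV" for \<alpha>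
    proof (rule has_sum_finite_neutralI[OF finite_Collect_le_fun[of \<alpha>]])
      have "norm (T (\<alpha>, \<beta>)) = c \<alpha> * ((\<Prod>l\<in>UNIV. real (\<alpha> l choose \<beta> l) * (P $ l) ^ (\<alpha> l - \<beta> l)) * monomial W \<beta>)" for \<beta>
        using c0[of \<alpha>] by (simp add: T_def B_def norm_mult norm_power monomial_def P_def W_def prod_norm[symmetric])
      then show "N \<alpha> = (\<Sum>\<beta> | \<forall>l. \<beta> l \<le> \<alpha> l. norm (T (\<alpha>, \<beta>)))"
        unfolding N_def binomial_expansion_vector by (simp add: sum_distrib_left)
    qed (use T0 in auto)
    have N_bound: "0 \<le> N \<alpha>" "N \<alpha> \<le> c \<alpha> * monomial X \<alpha>" for \<alpha>
    proof -
      show "0 \<le> N \<alpha>"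
        unfolding N_def using c0 by (intro mult_nonneg_nonneg prod_nonneg) (auto simp: W_def P_def)
      have "W $ l \<le> r" for l using z by (auto simp: W_def w_def dist_norm less_imp_le)
      then show "N \<alpha> \<le> c \<alpha> * monomial X \<alpha>"
        unfolding N_def monomial_def using c0
        by (intro mult_left_mono prod_mono conjI power_mono zero_le_power) (auto simp: W_def P_def X_def add.commute)
    qed
    have "(\<lambda>x. norm (T x)) summable_on (UNIV \<times> UNIV)"
      unfolding Infinite_Sum.abs_summable_on_Sigma_iff
    proof (intro conjI ballI)
      show "(\<lambda>\<beta>. norm (T (\<alpha>, \<beta>))) summable_on UNIV" for \<alpha>
        using norm_row[of \<alpha>] by (simp add: has_sum_iff)
      have "(\<lambda>\<alpha>. \<Sum>\<^sub>\<infinity>\<beta>. norm (T (\<alpha>, \<beta>))) = N" using norm_row by (auto simp: has_sum_iff)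
      moreover have "(\<lambda>\<alpha>. norm (N \<alpha>)) summable_on UNIV"
        using N_bound X_summable
        by (intro Infinite_Sum.abs_summable_on_comparison_test'[of "\<lambda>\<alpha>. c \<alpha> * monomial X \<alpha>"]) auto
      ultimately show "(\<lambda>\<alpha>. norm (\<Sum>\<^sub>\<infinity>\<beta>. norm (T (\<alpha>, \<beta>)))) summable_on UNIV" by metis
    qed
    then obtain S where S: "(T has_sum S) (UNIV \<times> UNIV)"
      using Infinite_Sum.abs_summable_summable by (auto simp: summable_on_def)
    have "((\<lambda>\<alpha>. complex_of_real (c \<alpha>) * monomial z \<alpha>) has_sum S) UNIV"
      by (rule has_sum_SigmaD[OF S]) (rule T_row)
    then have S_eq: "S = (\<Sum>\<^sub>\<infinity>\<alpha>. complex_of_real (c \<alpha>) * monomial z \<alpha>)" by (simp add: infsumI)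
    have swapped: "((\<lambda>(\<beta>, \<alpha>). T (\<alpha>, \<beta>)) has_sum S) (UNIV \<times> UNIV)"
      by (rule has_sum_swap[THEN iffD1, OF S])
    have "((\<lambda>\<beta>. a \<beta> * monomial w \<beta>) has_sum S) UNIV"
    proof (rule has_sum_SigmaD[OF swapped])
      fix \<beta>
      have "(\<lambda>\<alpha>. T (\<alpha>, \<beta>)) summable_on UNIV"
        using summable_on_SigmaD1[of "\<lambda>\<beta> \<alpha>. T (\<alpha>, \<beta>)" UNIV "\<lambda>_. UNIV" \<beta>] has_sum_imp_summable[OF swapped] by simp
      moreover have "(\<Sum>\<^sub>\<infinity>\<alpha>. T (\<alpha>, \<beta>)) = a \<beta> * monomial w \<beta>"
        unfolding T_def a_def by (simp add: infsum_cmult_left')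
      ultimately show "((\<lambda>\<alpha>. case (\<beta>, \<alpha>) of (\<beta>, \<alpha>) \<Rightarrow> T (\<alpha>, \<beta>)) has_sum a \<beta> * monomial w \<beta>) UNIV"
        by (simp add: has_sum_iff)
    qed
    then show ?thesis by (simp add: S_eq w_def)
  qed
  then show "\<exists>r>0. \<exists>a. \<forall>z. (\<forall>l. dist (z $ l) (p $ l) < r) \<longrightarrow>
      ((\<lambda>\<alpha>. a \<alpha> * monomial (z - p) \<alpha>) has_sum (\<Sum>\<^sub>\<infinity>\<alpha>. complex_of_real (c \<alpha>) * monomial z \<alpha>)) UNIV"
    using r(1) by blast
qed

lemma power_series_complex_extension:
  fixes F :: "real ^ 'm::finite \<Rightarrow> real"
  assumes F: "power_series_on_cube \<rho> c F" and x: "x \<in> open_cube \<rho>"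
  shows "(\<Sum>\<^sub>\<infinity>\<alpha>. complex_of_real (c \<alpha>) * monomial (\<chi> l. complex_of_real (x $ l)) \<alpha>) = complex_of_real (F x)"
proof -
  have "((\<lambda>\<alpha>. complex_of_real (c \<alpha> * monomial x \<alpha>)) has_sum complex_of_real (F x)) UNIV"
    using F x by (intro has_sum_of_real) (auto simp: power_series_on_cube_def)
  then show ?thesis by (intro infsumI) (simp add: monomial_def)
qed

section \<open>The theorem\<close>

theorem theorem9p6:
  fixes \<rho> :: ereal and y :: "real ^ 'm::finite" and F :: "real ^ 'm \<Rightarrow> real"
  assumes "0 < \<rho>"
    and "y \<in> Y_set"
    and "preserves_positivity_on F 2 {A. \<forall>l. A l \<in> P_mats 2 (open_interval \<rho>)}"
    and "\<And>N. N \<ge> 1 \<Longrightarrow> preserves_positivity_on F N {A. \<forall>l. A l \<in> H_plus \<rho> y N l}"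
  shows "absolutely_monotonic_on (open_cube \<rho>) F \<and>
    (\<exists>G :: complex ^ 'm \<Rightarrow> complex. multi_analytic_on G (polydisc \<rho>) \<and>
      (\<forall>x\<in>open_cube \<rho>. G (\<chi> l. complex_of_real (x $ l)) = complex_of_real (F x)))"
proof -
  have cont: "continuous_on (open_cube \<rho>) F"
    using assms(3) by (rule continuous_on_open_cube_if_preserves_2x2)
  have diff: "0 \<le> mixed_difference F \<alpha> h a"
    if "0 < h" "\<And>l. 0 < a $ l" "\<And>l. ereal (a $ l + h * real (\<alpha> l)) < \<rho>" for \<alpha> h a
    by (rule mixed_difference_nonneg[OF assms(2) cont _ that]) (rule hankel_positivity[OF assms(4)])
  obtain c where c: "power_series_on_cube \<rho> c F"
    by (rule power_series_if_mixed_differences_nonneg[OF assms(1) cont diff])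
  show ?thesis
    using power_series_imp_absolutely_monotonic[OF c cont] power_series_imp_multi_analytic[OF c]
      power_series_complex_extension[OF c] by blast
qed

end
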